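(* Let $L$ be a planar semimodular lattice, and let $\mathfrak{p}, \mathfrak{q}$ be distinct prime intervals in $L$. Then $\mathfrak{q}$ is collapsed by $\mathrm{con}(\mathfrak{p})$ if and only if there exist an integer $n \geq 0$ and sequences of prime intervals in $L$, $\mathfrak{p}_0 = \mathfrak{p}, \mathfrak{p}_1, \dots, \mathfrak{p}_n$ and $\mathfrak{q}_0, \mathfrak{q}_1, \dots, \mathfrak{q}_n = \mathfrak{q}$, where $\mathfrak{p}_k$ is SPS projective to $\mathfrak{q}_k$ for $k = 0,\dots, n$, and, provided that $n > 0$, $\mathfrak{q}_k$ switches to $\mathfrak{p}_{k+1}$ for $k=0,\dots, n-1$.
   Context: A planar lattice is by definition finite: a finite lattice having a planar Hasse diagram. Semimodular means upper semimodular. A prime interval $\mathfrak{p}=[0_{\mathfrak p},1_{\mathfrak p}]$ is an interval with $0_{\mathfrak p}$ covered by $1_{\mathfrak p}$. $\mathrm{con}(\mathfrak{p})$ is the least congruence of $L$ collapsing $0_{\mathfrak p}$ and $1_{\mathfrak p}$; $\mathfrak q$ is collapsed by a congruence if its two endpoints are congruent. Perspectivity: an interval $I=[0_I,1_I]$ is down perspective to $J=[0_J,1_J]$ if $0_I\vee 1_J=1_I$ and $0_I\wedge 1_J=0_J$; in that case $J$ is up perspective to $I$. $\mathsf{S}_7$ is the 7-element lattice with elements $u,y,o,x,a,m,i$ whose covering relations are $u\prec y$, $u\prec o$, $y\prec x$, $y\prec a$, $o\prec a$, $o\prec m$, $x\prec i$, $a\prec i$, $m\prec i$. Of its three dual atoms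 $x,a,m$, exactly one, $a=y\vee o$, is a proper join (i.e. join-reducible). Swing: for prime intervals $\mathfrak p,\mathfrak q$ in a lattice $L$, $\mathfrak p$ swings to $\mathfrak q$ if (i) $\mathfrak p\ne\mathfrak q$; (ii) $1_{\mathfrak p}=1_{\mathfrak q}$; (iii) there is a lower cover $c\neq 0_{\mathfrak p},0_{\mathfrak q}$ of $1_{\mathfrak p}$ such that $\{0_{\mathfrak p},0_{\mathfrak q},c\}$ generates a sublattice $S$ of $L$ isomorphic to $\mathsf{S}_7$, where $0_{\mathfrak q}$ is the unique dual atom of $S$ that is a proper join (in $S$). SPS projective: $\mathfrak p$ is SPS projective to $\mathfrak q$ if either $\mathfrak p=\mathfrak q$ or there exist a prime interval $\mathfrak r$ with $\mathfrak p$ up perspective to $\mathfrak r$ and a finite sequence of prime intervals $\mathfrak r=\mathfrak r_0,\mathfrak r_1,\dots,\mathfrak r_n=\mathfrak q$ such that, for each $k$ with $0\le k<n$, either $\mathfrak r_k$ is down perspective to $\mathfrak r_{k+1}$ or $\mathfrak r_k$ swings to $\mathfrak r_{k+1}$. Switch: for distinct prime intervals $\mathfrak p,\mathfrak q$ in $L$, $\mathfrak p$ switches to $\mathfrak q$ if both lie in a common covering $\mathsf{M}_3$ in $L$, i.e. in a common sublattice of $L$ that is isomorphic to $\mathsf{M}_3$ (the 5-element modular lattice of length 2 with three atoms) and whose covering relations are covering relations of $L$. *)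

theory Defs
  imports "HOL-Analysis.Analysis"
begin

definition covers_in :: "'a::order set \<Rightarrow> 'a \<Rightarrow> 'a \<Rightarrow> bool" where
  "covers_in S x y \<longleftrightarrow> x \<in> S \<and> y \<in> S \<and> x < y \<and> \<not> (\<exists>z\<in>S. x < z \<and> z < y)"

abbreviation covered_by :: "'a::order \<Rightarrow> 'a \<Rightarrow> bool" where
  "covered_by x y \<equiv> covers_in UNIV x y"

text \<open>
  Hasse diagrams are drawn with straight edges; the second coordinate is the height.
\<close>

definition planar_diagram :: "('a::order \<Rightarrow> real \<times> real) \<Rightarrow> bool" where
  "planar_diagram f \<longleftrightarrow>
     inj f \<and>
     (\<forall>x y. x < y \<longrightarrow> snd (f x) < snd (f y)) \<and>
     (\<forall>x y z. covered_by x y \<longrightarrow> f z \<in> closed_segment (f x) (f y) \<longrightarrow> z \<in> {x, y}) \<and>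
     (\<forall>x y x' y'. covered_by x y \<longrightarrow> covered_by x' y' \<longrightarrow> (x, y) \<noteq> (x', y') \<longrightarrow>
        closed_segment (f x) (f y) \<inter> closed_segment (f x') (f y') \<subseteq> f ` ({x, y} \<inter> {x', y'}))"

definition planar :: "'a::order itself \<Rightarrow> bool" where
  "planar _ \<longleftrightarrow> (\<exists>f :: 'a \<Rightarrow> real \<times> real. planar_diagram f)"

definition upper_semimodular :: "'a::lattice itself \<Rightarrow> bool" where
  "upper_semimodular _ \<longleftrightarrow>
     (\<forall>x y z :: 'a. covered_by x y \<longrightarrow> sup x z = sup y z \<or> covered_by (sup x z) (sup y z))"

text \<open>An interval is encoded as the pair of its lower and upper endpoint.\<close>

definition prime_interval :: "'a::order \<times> 'a \<Rightarrow> bool" where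
  "prime_interval p \<longleftrightarrow> covered_by (fst p) (snd p)"

definition lattice_congruence :: "('a::lattice \<times> 'a) set \<Rightarrow> bool" where
  "lattice_congruence \<theta> \<longleftrightarrow>
     equiv UNIV \<theta> \<and>
     (\<forall>a b c d. (a, b) \<in> \<theta> \<longrightarrow> (c, d) \<in> \<theta> \<longrightarrow>
        (sup a c, sup b d) \<in> \<theta> \<and> (inf a c, inf b d) \<in> \<theta>)"

definition collapsed_by :: "'a::lattice \<times> 'a \<Rightarrow> ('a \<times> 'a) set \<Rightarrow> bool" where
  "collapsed_by p \<theta> \<longleftrightarrow> (fst p, snd p) \<in> \<theta>"

definition con :: "'a::lattice \<times> 'a \<Rightarrow> ('a \<times> 'a) set" where
  "con p = \<Inter> {\<theta>. lattice_congruence \<theta> \<and> collapsed_by p \<theta>}"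

lemma lattice_congruence_con: "lattice_congruence (con p)"
proof -
  have equiv: "equiv UNIV \<theta>" if "lattice_congruence \<theta>" for \<theta> :: "('a \<times> 'a) set"
    using that by (simp add: lattice_congruence_def)
  have "equiv UNIV (con p)"
  proof (rule equivI)
    show "con p \<subseteq> UNIV \<times> UNIV" by simp
    show "refl (con p)"
      using equiv by (auto simp: con_def equiv_def refl_on_def)
    show "sym (con p)"
      using equiv by (auto simp: con_def equiv_def intro!: symI dest: symD)
    show "trans (con p)"
    proof (rule transI)
      fix x y z assume "(x, y) \<in> con p" "(y, z) \<in> con p"
      then show "(x, z) \<in> con p"
        using equiv unfolding con_def equiv_def by (blast dest: transD)
    qed
  qed
  then show ?thesis
    unfolding lattice_congruence_def by (auto simp: con_def lattice_congruence_def)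
qed

lemma collapsed_by_con: "collapsed_by p (con p)"
  by (simp add: con_def collapsed_by_def)

lemma con_least: "lattice_congruence \<theta> \<Longrightarrow> collapsed_by p \<theta> \<Longrightarrow> con p \<subseteq> \<theta>"
  by (auto simp: con_def)

definition sublattice :: "'a::lattice set \<Rightarrow> bool" where
  "sublattice S \<longleftrightarrow> (\<forall>x\<in>S. \<forall>y\<in>S. sup x y \<in> S \<and> inf x y \<in> S)"

definition generated_sublattice :: "'a::lattice set \<Rightarrow> 'a set" where
  "generated_sublattice X = \<Inter> {S. sublattice S \<and> X \<subseteq> S}"

datatype s7 = S7_u | S7_y | S7_o | S7_x | S7_a | S7_m | S7_i

definition s7_covers :: "(s7 \<times> s7) set" where
  "s7_covers = {(S7_u, S7_y), (S7_u, S7_o), (S7_y, S7_x), (S7_y, S7_a), (S7_o, S7_a),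
     (S7_o, S7_m), (S7_x, S7_i), (S7_a, S7_i), (S7_m, S7_i)}"

datatype m3 = M3_zero | M3_a | M3_b | M3_c | M3_one

definition m3_covers :: "(m3 \<times> m3) set" where
  "m3_covers = {(M3_zero, M3_a), (M3_zero, M3_b), (M3_zero, M3_c),
     (M3_a, M3_one), (M3_b, M3_one), (M3_c, M3_one)}"

text \<open>
  \<open>S\<close> is isomorphic to the lattice on the type \<open>'b\<close> whose covering relation is \<open>C\<close>.  For a
  sublattice \<open>S\<close>, an order isomorphism is the same as a lattice isomorphism.
\<close>

definition isomorphic_to :: "'a::order set \<Rightarrow> ('b \<times> 'b) set \<Rightarrow> bool" where
  "isomorphic_to S C \<longleftrightarrow>
     (\<exists>f. bij_betw f UNIV S \<and> (\<forall>x y. f x \<le> f y \<longleftrightarrow> (x, y) \<in> C\<^sup>*))"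

definition dual_atom_in :: "'a::order set \<Rightarrow> 'a \<Rightarrow> bool" where
  "dual_atom_in S d \<longleftrightarrow> (\<exists>t\<in>S. (\<forall>s\<in>S. s \<le> t) \<and> covers_in S d t)"

definition proper_join_in :: "'a::lattice set \<Rightarrow> 'a \<Rightarrow> bool" where
  "proper_join_in S d \<longleftrightarrow> d \<in> S \<and> (\<exists>v\<in>S. \<exists>w\<in>S. v < d \<and> w < d \<and> d = sup v w)"

definition down_perspective :: "'a::lattice \<times> 'a \<Rightarrow> 'a \<times> 'a \<Rightarrow> bool" where
  "down_perspective I J \<longleftrightarrow> sup (fst I) (snd J) = snd I \<and> inf (fst I) (snd J) = fst J"

definition up_perspective :: "'a::lattice \<times> 'a \<Rightarrow> 'a \<times> 'a \<Rightarrow> bool" where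
  "up_perspective J I \<longleftrightarrow> down_perspective I J"

definition swings_to :: "'a::lattice \<times> 'a \<Rightarrow> 'a \<times> 'a \<Rightarrow> bool" where
  "swings_to p q \<longleftrightarrow>
     prime_interval p \<and> prime_interval q \<and> p \<noteq> q \<and> snd p = snd q \<and>
     (\<exists>c S. covered_by c (snd p) \<and> c \<noteq> fst p \<and> c \<noteq> fst q \<and>
        S = generated_sublattice {fst p, fst q, c} \<and>
        isomorphic_to S s7_covers \<and>
        dual_atom_in S (fst q) \<and> proper_join_in S (fst q) \<and>
        (\<forall>d. dual_atom_in S d \<and> proper_join_in S d \<longrightarrow> d = fst q))"

definition sps_projective :: "'a::lattice \<times> 'a \<Rightarrow> 'a \<times> 'a \<Rightarrow> bool" where
  "sps_projective p q \<longleftrightarrow>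
     p = q \<or>
     (\<exists>r. prime_interval r \<and> up_perspective p r \<and>
        (\<exists>(n::nat) R. R 0 = r \<and> R n = q \<and> (\<forall>k\<le>n. prime_interval (R k)) \<and>
           (\<forall>k<n. down_perspective (R k) (R (Suc k)) \<or> swings_to (R k) (R (Suc k)))))"

definition covering_m3 :: "'a::lattice set \<Rightarrow> bool" where
  "covering_m3 S \<longleftrightarrow>
     sublattice S \<and> isomorphic_to S m3_covers \<and> (\<forall>x y. covers_in S x y \<longrightarrow> covered_by x y)"

definition switches_to :: "'a::lattice \<times> 'a \<Rightarrow> 'a \<times> 'a \<Rightarrow> bool" where
  "switches_to p q \<longleftrightarrow>
     prime_interval p \<and> prime_interval q \<and> p \<noteq> q \<and>
     (\<exists>S. covering_m3 S \<and> {fst p, snd p} \<subseteq> S \<and> {fst q, snd q} \<subseteq> S)"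

end

theory Submission
  imports Defs
begin

text \<open>
  Let \<open>Q\<close> be the set of prime intervals obtained from \<open>p\<close> by the steps of the theorem. Call a
  join-irreducible \<open>y\<close> with lower cover \<open>y'\<close> bad if \<open>(y', y)\<close> is not in \<open>Q\<close>. Identifying elements
  that have the same bad join-irreducibles below them gives a congruence that collapses \<open>p\<close> and no prime
  interval outside \<open>Q\<close>, provided that (1) \<open>Q\<close> is closed under up-perspectivities, and (2) if \<open>(a, b)\<close>
  is in \<open>Q\<close> and a join-irreducible \<open>y\<close> satisfies \<open>y \<le> b\<close> but not \<open>y \<le> a\<close>, then \<open>y\<close> is not bad.

  For (2), order the lower covers of \<open>b\<close> from left to right. If \<open>a\<close> lies between \<open>x\<close> and \<open>m\<close>, then
  planarity forces \<open>inf x m \<le> a\<close>; hence neighbours \<open>a, c\<close> cover \<open>inf a c\<close>, and every prime interval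
  \<open>(x, b)\<close> swings or switches to \<open>(a, b)\<close> for an adjacent \<open>a\<close> that is neither leftmost nor rightmost.
  Walking towards a lower cover of \<open>b\<close> above \<open>y\<close> and stepping down just before reaching it replaces
  \<open>b\<close> by a smaller element. For (1), planarity shows that the end \<open>(a, b)\<close> of a swing has \<open>b\<close> as the
  only upper cover of \<open>a\<close>, and that three upper covers of an element are the atoms of a covering \<open>M\<^sub>3\<close>.

  The planarity facts compare monotone paths in the diagram as continuous functions of the height: by
  the intermediate value theorem, paths that change sides meet, and by planarity they meet in a vertex.
\<close>

subsection \<open>Covers and perspectivities\<close>

lemma covered_byD: "covered_by x y \<Longrightarrow> x < y"
  by (simp add: covers_in_def)

lemma covered_by_between: "covered_by x y \<Longrightarrow> x \<le> z \<Longrightarrow> z \<le> y \<Longrightarrow> z = x \<or> z = y"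
  by (auto simp: covers_in_def less_le)

lemma sup_eq_of_covered_by:
  fixes a b :: "'a::lattice"
  assumes "covered_by a b" "y \<le> b" "\<not> y \<le> a"
  shows "sup a y = b"
  using covered_by_between[OF assms(1), of "sup a y"] assms covered_byD[OF assms(1)]
  by (metis le_sup_iff order.strict_implies_order order_refl sup_ge1)

lemma covered_by_sup_eq:
  fixes a b :: "'a::lattice"
  assumes "covered_by a b" "covered_by c b" "a \<noteq> c"
  shows "sup a c = b" "\<not> c \<le> a"
proof -
  show *: "\<not> c \<le> a"
    using covered_by_between[OF assms(2), of a] assms covered_byD[OF assms(1)] by (auto simp: less_le)
  show "sup a c = b"
    using sup_eq_of_covered_by[OF assms(1) _ *] covered_byD[OF assms(2)] by auto
qed

lemma ex_upper_cover:
  fixes x y :: "'a::{finite, order}"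
  assumes "x < y"
  shows "\<exists>z. covered_by x z \<and> z \<le> y"
proof -
  obtain z where "z \<in> {z. x < z \<and> z \<le> y}" "\<And>w. w \<in> {z. x < z \<and> z \<le> y} \<Longrightarrow> w \<le> z \<Longrightarrow> w = z"
    using finite_has_minimal[of "{z. x < z \<and> z \<le> y}"] assms by force
  then show ?thesis
    by (intro exI[of _ z]) (force simp: covers_in_def)
qed

lemma ex_lower_cover:
  fixes x y :: "'a::{finite, order}"
  assumes "x < y"
  shows "\<exists>z. covered_by z y \<and> x \<le> z"
proof -
  obtain z where "z \<in> {z. z < y \<and> x \<le> z}" "\<And>w. w \<in> {z. z < y \<and> x \<le> z} \<Longrightarrow> z \<le> w \<Longrightarrow> z = w"
    using finite_has_maximal[of "{z. z < y \<and> x \<le> z}"] assms by force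
  then show ?thesis
    by (intro exI[of _ z]) (force simp: covers_in_def)
qed

lemma covered_by_chain:
  fixes x y :: "'a::{finite, order}"
  assumes "x \<le> y"
  shows "covered_by\<^sup>*\<^sup>* x y"
proof (rule ccontr)
  define A where "A = {z. z \<le> y \<and> \<not> covered_by\<^sup>*\<^sup>* z y}"
  assume "\<not> covered_by\<^sup>*\<^sup>* x y"
  then have "A \<noteq> {}" using assms by (auto simp: A_def)
  then obtain z where z: "z \<in> A" "\<And>w. w \<in> A \<Longrightarrow> z \<le> w \<Longrightarrow> z = w"
    using finite_has_maximal[of A] by auto
  then have "z < y" by (auto simp: less_le A_def)
  then obtain w where w: "covered_by z w" "w \<le> y" using ex_upper_cover by blast
  then have "w \<notin> A" using z(2)[of w] covered_byD[OF w(1)] by (auto simp: less_le)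
  then have "covered_by\<^sup>*\<^sup>* w y" using w(2) by (simp add: A_def)
  then have "covered_by\<^sup>*\<^sup>* z y"
    using w(1) by (rule converse_rtranclp_into_rtranclp[rotated])
  then show False using z(1) by (simp add: A_def)
qed

lemma semimodular_covered_by:
  fixes x y z :: "'a::lattice"
  assumes "upper_semimodular TYPE('a)" "covered_by x y" "x \<le> z" "\<not> y \<le> z"
  shows "covered_by z (sup y z)"
  using assms unfolding upper_semimodular_def by (metis sup.absorb2 sup.cobounded1)

lemma down_perspective_iff:
  "down_perspective (a, b) (c, d) \<longleftrightarrow> sup a d = b \<and> inf a d = c"
  by (simp add: down_perspective_def)

lemma down_perspective_refl: "prime_interval p \<Longrightarrow> down_perspective p p"
  by (auto simp: down_perspective_def prime_interval_def sup.absorb2 inf.absorb1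
      less_imp_le covered_byD)

lemma down_perspective_trans:
  assumes "down_perspective p q" "down_perspective q r"
  shows "down_perspective p r"
proof -
  obtain a b c d e g where [simp]: "p = (a, b)" "q = (c, d)" "r = (e, g)"
    by (metis surj_pair)
  have *: "sup a d = b" "inf a d = c" "sup c g = d" "inf c g = e"
    using assms by (auto simp: down_perspective_iff)
  have "sup a g = sup (sup a c) g" using * by (metis inf_sup_absorb sup_inf_absorb)
  then have "sup a g = b" using * by (simp add: sup.assoc)
  moreover have "inf a g = inf (inf a d) g"
    using * by (metis inf.absorb2 inf.assoc sup_ge2)
  ultimately show ?thesis using * by (simp add: down_perspective_iff)
qed

subsection \<open>The steps preserve collapsing\<close>

lemma congruence_refl: "lattice_congruence \<theta> \<Longrightarrow> (a, a) \<in> \<theta>"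
  by (simp add: lattice_congruence_def equiv_def refl_on_def)

lemma congruence_sym: "lattice_congruence \<theta> \<Longrightarrow> (a, b) \<in> \<theta> \<Longrightarrow> (b, a) \<in> \<theta>"
  by (auto simp: lattice_congruence_def equiv_def dest: symD)

lemma congruence_trans:
  "lattice_congruence \<theta> \<Longrightarrow> (a, b) \<in> \<theta> \<Longrightarrow> (b, c) \<in> \<theta> \<Longrightarrow> (a, c) \<in> \<theta>"
  by (auto simp: lattice_congruence_def equiv_def dest: transD)

lemma congruence_sup: "lattice_congruence \<theta> \<Longrightarrow> (a, b) \<in> \<theta> \<Longrightarrow> (sup a c, sup b c) \<in> \<theta>"
  using congruence_refl[of \<theta> c] by (auto simp: lattice_congruence_def)

lemma congruence_inf: "lattice_congruence \<theta> \<Longrightarrow> (a, b) \<in> \<theta> \<Longrightarrow> (inf a c, inf b c) \<in> \<theta>"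
  using congruence_refl[of \<theta> c] by (auto simp: lattice_congruence_def)

lemma congruence_convex:
  assumes "lattice_congruence \<theta>" "(a, b) \<in> \<theta>" "a \<le> x" "x \<le> b" "a \<le> y" "y \<le> b"
  shows "(x, y) \<in> \<theta>"
proof -
  have "(x, b) \<in> \<theta>" "(y, b) \<in> \<theta>"
    using congruence_sup[OF assms(1,2), of x] congruence_sup[OF assms(1,2), of y] assms
    by (simp_all add: sup.absorb1 sup.absorb2)
  then show ?thesis using assms(1) congruence_sym congruence_trans by blast
qed

text \<open>Joining with \<open>a\<close> carries \<open>(c, d)\<close> to \<open>(a, b)\<close>,
  and meeting with \<open>d\<close> carries \<open>(a, b)\<close> back to
  \<open>(c, d)\<close>.\<close>

lemma collapsed_by_down_perspective:
  assumes "lattice_congruence \<theta>" "down_perspective p q"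
  shows "collapsed_by p \<theta> \<longleftrightarrow> collapsed_by q \<theta>"
proof -
  obtain a b c d where [simp]: "p = (a, b)" "q = (c, d)" by (metis surj_pair)
  have *: "sup a d = b" "inf a d = c" using assms(2) by (auto simp: down_perspective_iff)
  then have "sup c a = a" "sup d a = b" "inf b d = d"
    by (auto simp: sup.commute inf.commute sup.absorb2 inf.absorb1)
  then show ?thesis
    using congruence_sup[OF assms(1), of c d a] congruence_inf[OF assms(1), of a b d] *
    by (auto simp: collapsed_by_def)
qed

text \<open>A computable form of the order generated by \<open>s7_covers\<close>, so that questions
  about a copy of S7 are settled by cases on its elements.\<close>

fun s7_le :: "s7 \<Rightarrow> s7 \<Rightarrow> bool" where
  "s7_le S7_u _ = True"
| "s7_le S7_y t = (t \<in> {S7_y, S7_x, S7_a, S7_i})"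
| "s7_le S7_o t = (t \<in> {S7_o, S7_a, S7_m, S7_i})"
| "s7_le S7_i t = (t = S7_i)"
| "s7_le s t = (t = s \<or> t = S7_i)"

lemma rtrancl_s7_covers_iff: "(s, t) \<in> s7_covers\<^sup>* \<longleftrightarrow> s7_le s t"
proof
  assume "(s, t) \<in> s7_covers\<^sup>*"
  then show "s7_le s t"
  proof (induction rule: rtrancl_induct)
    case base
    show ?case by (cases s) auto
  next
    case (step v w)
    show ?case using step.hyps(2) step.IH by (cases s) (auto simp: s7_covers_def)
  qed
next
  have c: "(S7_u, S7_y) \<in> s7_covers\<^sup>*" "(S7_u, S7_o) \<in> s7_covers\<^sup>*" "(S7_y, S7_x) \<in> s7_covers\<^sup>*"
    "(S7_y, S7_a) \<in> s7_covers\<^sup>*" "(S7_o, S7_a) \<in> s7_covers\<^sup>*" "(S7_o, S7_m) \<in> s7_covers\<^sup>*"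
    "(S7_x, S7_i) \<in> s7_covers\<^sup>*" "(S7_a, S7_i) \<in> s7_covers\<^sup>*" "(S7_m, S7_i) \<in> s7_covers\<^sup>*"
    by (auto simp: s7_covers_def)
  note c2 = rtrancl_trans[OF c(1) c(3)] rtrancl_trans[OF c(1) c(4)] rtrancl_trans[OF c(2) c(6)]
    rtrancl_trans[OF c(3) c(7)] rtrancl_trans[OF c(6) c(9)]
  note c3 = rtrancl_trans[OF c2(1) c(7)]
  assume "s7_le s t"
  then show "(s, t) \<in> s7_covers\<^sup>*"
    using c c2 c3 by (cases s; cases t) auto
qed

fun m3_le :: "m3 \<Rightarrow> m3 \<Rightarrow> bool" where
  "m3_le M3_zero _ = True"
| "m3_le M3_one t = (t = M3_one)"
| "m3_le s t = (t = s \<or> t = M3_one)"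

lemma rtrancl_m3_covers_iff: "(s, t) \<in> m3_covers\<^sup>* \<longleftrightarrow> m3_le s t"
proof
  assume "(s, t) \<in> m3_covers\<^sup>*"
  then show "m3_le s t"
  proof (induction rule: rtrancl_induct)
    case base
    show ?case by (cases s) auto
  next
    case (step v w)
    show ?case using step.hyps(2) step.IH by (cases s) (auto simp: m3_covers_def)
  qed
next
  have c: "(M3_zero, M3_a) \<in> m3_covers\<^sup>*" "(M3_zero, M3_b) \<in> m3_covers\<^sup>*"
    "(M3_zero, M3_c) \<in> m3_covers\<^sup>*" "(M3_a, M3_one) \<in> m3_covers\<^sup>*"
    "(M3_b, M3_one) \<in> m3_covers\<^sup>*" "(M3_c, M3_one) \<in> m3_covers\<^sup>*"
    by (auto simp: m3_covers_def)
  note c2 = rtrancl_trans[OF c(1) c(4)]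
  assume "m3_le s t"
  then show "(s, t) \<in> m3_covers\<^sup>*"
    using c c2 by (cases s; cases t) auto
qed

text \<open>The three facts extracted here say that \<open>fst q\<close> lies between the other two dual atoms of the
  copy of \<open>S\<^sub>7\<close>; they are all that is needed of a swing.\<close>

lemma swings_toE:
  assumes "swings_to p q"
  obtains c where "covered_by c (snd p)" "covered_by (fst p) (snd p)" "covered_by (fst q) (snd p)"
    "fst p \<noteq> fst q" "c \<noteq> fst p" "c \<noteq> fst q" "inf (fst p) c \<le> fst q"
    "\<not> inf (fst p) (fst q) \<le> c" "\<not> inf (fst q) c \<le> fst p"
proof -
  obtain c S where pq: "prime_interval p" "prime_interval q" "p \<noteq> q" "snd p = snd q"
    and c: "covered_by c (snd p)" "c \<noteq> fst p" "c \<noteq> fst q"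
    and S: "S = generated_sublattice {fst p, fst q, c}"
    and iso: "isomorphic_to S s7_covers" and pj: "proper_join_in S (fst q)"
    using assms unfolding swings_to_def by blast
  define i where "i = snd p"
  have cov: "covered_by (fst p) i" "covered_by (fst q) i" "covered_by c i"
    using pq c by (auto simp: prime_interval_def i_def)
  have ne: "fst p \<noteq> fst q" using pq by (auto simp: prod_eq_iff)
  obtain F where bij: "bij_betw F UNIV S" and F: "\<And>s t. F s \<le> F t \<longleftrightarrow> s7_le s t"
    using iso unfolding isomorphic_to_def rtrancl_s7_covers_iff by blast
  have SF: "S = range F" using bij by (simp add: bij_betw_def)
  have Flt: "F s < F t \<longleftrightarrow> s7_le s t \<and> \<not> s7_le t s" for s t
    by (simp add: less_le_not_le F)
  have sub: "sublattice S"
    unfolding S generated_sublattice_def sublattice_def by blast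
  have gen: "fst p \<in> S" "fst q \<in> S" "c \<in> S"
    unfolding S generated_sublattice_def by auto
  \<comment> \<open>All generators lie below \<open>i\<close>, hence so does the sublattice they
    generate; since \<open>i\<close> is the join of two of them, it is the top
    \<open>F S7_i\<close>.\<close>
  have "sublattice {..i}" by (auto simp: sublattice_def intro: le_infI1)
  then have Si: "S \<subseteq> {..i}"
    using cov unfolding S generated_sublattice_def by (auto dest!: covered_byD)
  have "i \<in> S"
    using sub gen covered_by_sup_eq(1)[OF cov(1,2) ne] unfolding sublattice_def by metis
  then obtain k where "F k = i" using SF by auto
  moreover have "s7_le k S7_i" by (cases k) auto
  then have "F k \<le> F S7_i" using F by simp
  ultimately have i: "F S7_i = i" using Si SF by (auto intro: antisym)
  \<comment> \<open>A lower cover of \<open>i\<close> in the whole lattice is none of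
    \<open>F S7_u\<close>, \<open>F S7_y\<close>, \<open>F S7_o\<close>: one of
    \<open>F S7_y\<close>, \<open>F S7_a\<close> would lie strictly in between.\<close>
  have coatom: "s \<in> {S7_x, S7_a, S7_m}" if "covered_by (F s) i" for s
  proof -
    have *: "\<not> (F s < F t \<and> F t < F S7_i)" for t
      using that i by (auto simp: covers_in_def)
    have "F s < F S7_i" using that covered_byD i by simp
    then show ?thesis
      using *[of S7_y] *[of S7_a] by (cases s) (auto simp: Flt)
  qed
  obtain kp kq kc where k: "fst p = F kp" "fst q = F kq" "c = F kc" using gen SF by auto
  have ks: "kp \<in> {S7_x, S7_a, S7_m}" "kq \<in> {S7_x, S7_a, S7_m}" "kc \<in> {S7_x, S7_a, S7_m}"
    using coatom cov k by auto
  obtain v w where vw: "F v < F kq" "F w < F kq" "F kq = sup (F v) (F w)"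
    using pj SF unfolding proper_join_in_def k by auto
  \<comment> \<open>In S7 everything strictly below \<open>S7_x\<close> is below
    \<open>S7_y\<close>, and everything strictly below \<open>S7_m\<close> is below
    \<open>S7_o\<close>, so neither is a join of smaller elements.\<close>
  have "kq = S7_a"
  proof -
    have "kq \<noteq> S7_x"
    proof
      assume "kq = S7_x"
      then have "F v \<le> F S7_y"
        using vw(1) unfolding F Flt by (cases v) auto
      moreover have "F w \<le> F S7_y"
        using vw(2) \<open>kq = S7_x\<close> unfolding F Flt by (cases w) auto
      ultimately have "F S7_x \<le> F S7_y" using vw(3) \<open>kq = S7_x\<close> by simp
      then show False by (simp add: F)
    qed
    moreover have "kq \<noteq> S7_m"
    proof
      assume "kq = S7_m"
      then have "F v \<le> F S7_o"
        using vw(1) unfolding F Flt by (cases v) auto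
      moreover have "F w \<le> F S7_o"
        using vw(2) \<open>kq = S7_m\<close> unfolding F Flt by (cases w) auto
      ultimately have "F S7_m \<le> F S7_o" using vw(3) \<open>kq = S7_m\<close> by simp
      then show False by (simp add: F)
    qed
    ultimately show ?thesis using ks by blast
  qed
  then have kpc: "kp = S7_x \<and> kc = S7_m \<or> kp = S7_m \<and> kc = S7_x"
    using ks k ne c by auto
  have xm: "inf (F S7_x) (F S7_m) \<le> F S7_a"
  proof -
    have "inf (F S7_x) (F S7_m) \<in> S" using sub SF unfolding sublattice_def by auto
    then obtain z where z: "F z = inf (F S7_x) (F S7_m)" using SF by auto
    then have "F z \<le> F S7_x" "F z \<le> F S7_m" by simp_all
    then have "F z \<le> F S7_a" unfolding F by (cases z) auto
    then show ?thesis using z by simp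
  qed
  have xa: "\<not> inf (F S7_x) (F S7_a) \<le> F S7_m"
  proof
    have "F S7_y \<le> inf (F S7_x) (F S7_a)" by (simp add: F)
    also assume "inf (F S7_x) (F S7_a) \<le> F S7_m"
    finally show False by (simp add: F)
  qed
  have am: "\<not> inf (F S7_a) (F S7_m) \<le> F S7_x"
  proof
    have "F S7_o \<le> inf (F S7_a) (F S7_m)" by (simp add: F)
    also assume "inf (F S7_a) (F S7_m) \<le> F S7_x"
    finally show False by (simp add: F)
  qed
  show thesis
  proof (rule that[of c])
    show "inf (fst p) c \<le> fst q" "\<not> inf (fst p) (fst q) \<le> c" "\<not> inf (fst q) c \<le> fst p"
      using kpc xm xa am by (auto simp: k \<open>kq = S7_a\<close> inf.commute)
  qed (use cov c ne in \<open>auto simp: i_def\<close>)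
qed

text \<open>Meeting \<open>p\<close> with \<open>c\<close> identifies \<open>inf (fst p) c\<close>
  with \<open>c\<close>. Joining with \<open>y = inf (fst p) (fst q)\<close> turns this pair into
  \<open>y\<close> and \<open>snd p\<close>, because \<open>inf (fst p) c \<le> y\<close> and
  \<open>y\<close> is not below \<open>c\<close>. The interval \<open>q\<close> lies between these
  two.\<close>

lemma collapsed_by_swing:
  assumes \<theta>: "lattice_congruence \<theta>" "swings_to p q" "collapsed_by p \<theta>"
  shows "collapsed_by q \<theta>"
proof -
  obtain c where c: "covered_by c (snd p)" "covered_by (fst p) (snd p)" "covered_by (fst q) (snd p)"
    "fst p \<noteq> fst q" "c \<noteq> fst p" "c \<noteq> fst q" "inf (fst p) c \<le> fst q"
    "\<not> inf (fst p) (fst q) \<le> c" "\<not> inf (fst q) c \<le> fst p"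
    using assms(2) by (rule swings_toE)
  have sq: "snd q = snd p" using assms(2) by (simp add: swings_to_def)
  define y where "y = inf (fst p) (fst q)"
  have "(fst p, snd p) \<in> \<theta>" using assms(3) by (simp add: collapsed_by_def)
  from congruence_inf[OF \<theta>(1) this, of c] have "(inf (fst p) c, c) \<in> \<theta>"
    using covered_byD[OF c(1)] by (simp add: inf.absorb2)
  from congruence_sup[OF \<theta>(1) this, of y] have "(sup (inf (fst p) c) y, sup c y) \<in> \<theta>" .
  moreover have "sup (inf (fst p) c) y = y" using c(7) by (simp add: y_def sup.absorb2)
  moreover have "sup c y = snd p"
    using sup_eq_of_covered_by[OF c(1), of y] c(8) covered_byD[OF c(2)]
    by (metis inf.cobounded1 less_imp_le order_trans y_def)
  ultimately have "(y, snd p) \<in> \<theta>" by simp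
  then have "(fst q, snd p) \<in> \<theta>"
    using congruence_convex[OF \<theta>(1)] covered_byD[OF c(3)] by (simp add: y_def le_infI2 less_imp_le)
  then show ?thesis by (simp add: collapsed_by_def sq)
qed

text \<open>M3 is simple. If an atom is identified with zero, joining with the other two atoms
  identifies both with one, and their meet identifies zero with one (\<open>up\<close>). If an atom
  is identified with one, meeting with another atom leads back to that case
  (\<open>dn\<close>).\<close>

lemma collapsed_by_switch:
  assumes \<theta>: "lattice_congruence \<theta>" "switches_to p q" "collapsed_by p \<theta>"
  shows "collapsed_by q \<theta>"
proof -
  obtain S where S: "covering_m3 S" "{fst p, snd p} \<subseteq> S" "{fst q, snd q} \<subseteq> S"
    and p: "prime_interval p"
    using assms(2) unfolding switches_to_def by blast
  then have sub: "sublattice S" by (simp add: covering_m3_def)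
  obtain F where bij: "bij_betw F UNIV S" and F: "\<And>s t. F s \<le> F t \<longleftrightarrow> m3_le s t"
    using S unfolding covering_m3_def isomorphic_to_def rtrancl_m3_covers_iff by blast
  have SF: "S = range F" using bij by (simp add: bij_betw_def)
  have inf0: "inf (F s) (F t) = F M3_zero" if "s \<noteq> t" "s \<in> {M3_a, M3_b, M3_c}" "t \<in> {M3_a, M3_b, M3_c}" for s t
  proof -
    have "inf (F s) (F t) \<in> S" using sub SF unfolding sublattice_def by auto
    then obtain z where z: "F z = inf (F s) (F t)" using SF by auto
    then have "F z \<le> F s" "F z \<le> F t" by simp_all
    then have "z = M3_zero" unfolding F using that by (cases z) auto
    then show ?thesis using z by simp
  qed
  have sup1: "sup (F s) (F t) = F M3_one" if "s \<noteq> t" "s \<in> {M3_a, M3_b, M3_c}" "t \<in> {M3_a, M3_b, M3_c}" for s t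
  proof -
    have "sup (F s) (F t) \<in> S" using sub SF unfolding sublattice_def by auto
    then obtain z where z: "F z = sup (F s) (F t)" using SF by auto
    then have "F s \<le> F z" "F t \<le> F z" by simp_all
    then have "z = M3_one" unfolding F using that by (cases z) auto
    then show ?thesis using z by simp
  qed
  have zero: "F M3_zero \<le> F s" "F s \<le> F M3_one" for s
    unfolding F by (cases s; simp)+
  have up: "(F M3_zero, F M3_one) \<in> \<theta>"
    if h: "(F M3_zero, F s) \<in> \<theta>" "s \<in> {M3_a, M3_b, M3_c}" for s
  proof -
    have *: "(F t, F M3_one) \<in> \<theta>" if "t \<in> {M3_a, M3_b, M3_c}" "t \<noteq> s" for t
      using congruence_sup[OF \<theta>(1) h(1), of "F t"] sup1[of s t] that h(2) zero
      by (simp add: sup.absorb2)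
    obtain t t' where t: "t \<in> {M3_a, M3_b, M3_c}" "t' \<in> {M3_a, M3_b, M3_c}" "t \<noteq> s" "t' \<noteq> s" "t \<noteq> t'"
      using h(2) by auto
    have "(inf (F t) (F t'), inf (F M3_one) (F M3_one)) \<in> \<theta>"
      using *[OF t(1,3)] *[OF t(2,4)] \<theta>(1) unfolding lattice_congruence_def by blast
    then show ?thesis using inf0[OF t(5,1,2)] by simp
  qed
  have dn: "(F M3_zero, F M3_one) \<in> \<theta>"
    if h: "(F s, F M3_one) \<in> \<theta>" "s \<in> {M3_a, M3_b, M3_c}" for s
  proof -
    obtain t where t: "t \<in> {M3_a, M3_b, M3_c}" "t \<noteq> s"
      using h(2) by auto
    have "(F M3_zero, F t) \<in> \<theta>"
      using congruence_inf[OF \<theta>(1) h(1), of "F t"] inf0[of s t] t h(2) zero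
      by (simp add: inf.absorb2)
    then show ?thesis using up t by blast
  qed
  obtain k l where k: "fst p = F k" "snd p = F l" using S SF by auto
  have "F k < F l" using p k by (simp add: prime_interval_def covers_in_def)
  then have kl: "m3_le k l" "\<not> m3_le l k" by (auto simp: less_le_not_le F)
  have "(F k, F l) \<in> \<theta>" using assms(3) by (simp add: collapsed_by_def k)
  then have "(F M3_zero, F M3_one) \<in> \<theta>"
  proof (cases "k = M3_zero")
    case True
    then show ?thesis using \<open>(F k, F l) \<in> \<theta>\<close> up[of l] kl by (cases l) simp_all
  next
    case False
    then have "l = M3_one" "k \<in> {M3_a, M3_b, M3_c}" using kl by (cases k; cases l; simp)+
    then show ?thesis using \<open>(F k, F l) \<in> \<theta>\<close> dn[of k] by simp
  qed
  moreover obtain k' l' where "fst q = F k'" "snd q = F l'" using S(3) SF by auto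
  ultimately show ?thesis
    unfolding collapsed_by_def using zero congruence_convex[OF \<theta>(1)] by metis
qed

subsection \<open>Paths in a planar diagram\<close>

text \<open>A rising path given by its horizontal coordinate \<open>\<phi>\<close> as a function of
  the height. \<open>V\<close> contains the vertices whose edges the path may use, so that a
  crossing of two paths can be traced to a vertex; \<open>u = v\<close> allows a path that is a
  single point.\<close>

definition edge_path ::
  "('a::order \<Rightarrow> real \<times> real) \<Rightarrow> 'a set \<Rightarrow> (real \<Rightarrow> real) \<Rightarrow> real \<Rightarrow> real \<Rightarrow> bool" where
  "edge_path f V \<phi> s t \<longleftrightarrow> continuous_on {s..t} \<phi> \<and>
     (\<forall>\<tau>\<in>{s..t}. \<exists>u\<in>V. \<exists>v\<in>V. (u = v \<or> covered_by u v) \<and>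
        (\<phi> \<tau>, \<tau>) \<in> closed_segment (f u) (f v))"

text \<open>Horizontal displacement per unit of height. Edges of a diagram are never horizontal, so
  it is meaningful for every cover and orders the edges sharing an endpoint.\<close>

definition slope :: "('a \<Rightarrow> real \<times> real) \<Rightarrow> 'a \<Rightarrow> 'a \<Rightarrow> real" where
  "slope f x y = (fst (f y) - fst (f x)) / (snd (f y) - snd (f x))"

lemma edge_path_subset:
  assumes "edge_path f V \<phi> s t" "V \<subseteq> W"
  shows "edge_path f W \<phi> s t"
  unfolding edge_path_def
proof (intro conjI ballI)
  show "continuous_on {s..t} \<phi>" using assms(1) by (simp add: edge_path_def)
  fix \<tau> assume "\<tau> \<in> {s..t}"
  then obtain u v where "u \<in> V" "v \<in> V" "u = v \<or> covered_by u v" "(\<phi> \<tau>, \<tau>) \<in> closed_segment (f u) (f v)"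
    using assms(1) unfolding edge_path_def by blast
  then show "\<exists>u\<in>W. \<exists>v\<in>W. (u = v \<or> covered_by u v) \<and> (\<phi> \<tau>, \<tau>) \<in> closed_segment (f u) (f v)"
    using assms(2) by blast
qed

lemma edge_path_join:
  assumes "edge_path f V \<phi> s t" "edge_path f W \<psi> t r" "\<phi> t = \<psi> t" "s \<le> t" "t \<le> r"
  shows "edge_path f (V \<union> W) (\<lambda>\<tau>. if \<tau> \<le> t then \<phi> \<tau> else \<psi> \<tau>) s r"
  unfolding edge_path_def
proof (intro conjI ballI)
  have "continuous_on ({s..t} \<union> {t..r}) (\<lambda>\<tau>. if \<tau> \<le> t then \<phi> \<tau> else \<psi> \<tau>)"
    using assms by (intro continuous_on_cases) (auto simp: edge_path_def)
  moreover have "{s..t} \<union> {t..r} = {s..r}" using assms by auto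
  ultimately show "continuous_on {s..r} (\<lambda>\<tau>. if \<tau> \<le> t then \<phi> \<tau> else \<psi> \<tau>)" by simp
next
  fix \<tau> assume \<tau>: "\<tau> \<in> {s..r}"
  have *: "edge_path f (V \<union> W) \<phi> s t" "edge_path f (V \<union> W) \<psi> t r"
    using assms edge_path_subset by blast+
  show "\<exists>u\<in>V \<union> W. \<exists>v\<in>V \<union> W. (u = v \<or> covered_by u v) \<and>
      (if \<tau> \<le> t then \<phi> \<tau> else \<psi> \<tau>, \<tau>) \<in> closed_segment (f u) (f v)"
  proof (cases "\<tau> \<le> t")
    case True
    then have "\<tau> \<in> {s..t}" using \<tau> by auto
    then show ?thesis using True *(1) unfolding edge_path_def by simp
  next
    case False
    then have "\<tau> \<in> {t..r}" using \<tau> by auto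
    then show ?thesis using False *(2) unfolding edge_path_def by simp
  qed
qed

text \<open>The product is nonnegative exactly when \<open>\<psi>\<close> lies weakly between
  \<open>\<phi>\<close> and \<open>\<omega>\<close>, whichever of these is on the left. A change of
  its sign therefore makes \<open>\<psi>\<close> meet one of the two, without a distinction of
  sides.\<close>

lemma continuous_sign_change:
  fixes \<phi> \<psi> \<omega> :: "real \<Rightarrow> real"
  assumes cont: "continuous_on {s..t} \<phi>" "continuous_on {s..t} \<psi>" "continuous_on {s..t} \<omega>"
    and "s \<le> t"
    and ends: "(\<psi> s - \<phi> s) * (\<omega> s - \<psi> s) \<le> 0 \<and> 0 \<le> (\<psi> t - \<phi> t) * (\<omega> t - \<psi> t) \<or>
      0 \<le> (\<psi> s - \<phi> s) * (\<omega> s - \<psi> s) \<and> (\<psi> t - \<phi> t) * (\<omega> t - \<psi> t) \<le> 0"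
  shows "\<exists>\<tau>\<in>{s..t}. \<psi> \<tau> = \<phi> \<tau> \<or> \<psi> \<tau> = \<omega> \<tau>"
proof -
  have "continuous_on {s..t} (\<lambda>\<tau>. (\<psi> \<tau> - \<phi> \<tau>) * (\<omega> \<tau> - \<psi> \<tau>))"
    by (intro continuous_intros cont)
  then have "\<exists>\<tau>. s \<le> \<tau> \<and> \<tau> \<le> t \<and> (\<psi> \<tau> - \<phi> \<tau>) * (\<omega> \<tau> - \<psi> \<tau>) = 0"
    using ends \<open>s \<le> t\<close> IVT'[of "\<lambda>\<tau>. (\<psi> \<tau> - \<phi> \<tau>) * (\<omega> \<tau> - \<psi> \<tau>)" s 0 t]
      IVT2'[of "\<lambda>\<tau>. (\<psi> \<tau> - \<phi> \<tau>) * (\<omega> \<tau> - \<psi> \<tau>)" t 0 s] by blast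
  then show ?thesis by (metis atLeastAtMost_iff eq_iff_diff_eq_0 mult_eq_0_iff)
qed

text \<open>Three lines through one point: the one with the middle slope runs between the others
  both above and below that point.\<close>

lemma between_lines_nonneg:
  fixes p q r :: real
  assumes "p < q" "q < r" "\<phi> = c + p * d" "\<psi> = c + q * d" "\<omega> = c + r * d"
  shows "0 \<le> (\<psi> - \<phi>) * (\<omega> - \<psi>)"
proof -
  have "(\<psi> - \<phi>) * (\<omega> - \<psi>) = ((q - p) * (r - q)) * (d * d)"
    unfolding assms(3-5) by (simp add: algebra_simps)
  then show ?thesis using assms(1,2) by simp
qed

locale planar_lattice =
  fixes f :: "'a::{finite, lattice} \<Rightarrow> real \<times> real"
  assumes diagram: "planar_diagram f"
begin

abbreviation "h x \<equiv> snd (f x)"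
abbreviation "g x \<equiv> fst (f x)"

lemma height_less: "x < y \<Longrightarrow> h x < h y"
  using diagram by (simp add: planar_diagram_def)

lemma height_mono: "x \<le> y \<Longrightarrow> h x \<le> h y"
  using height_less by (force simp: le_less)

lemma height_in_segment:
  assumes "x \<le> y" "p \<in> closed_segment (f x) (f y)"
  shows "h x \<le> snd p" "snd p \<le> h y"
proof -
  obtain u where u: "0 \<le> u" "u \<le> 1" "p = (1 - u) *\<^sub>R f x + u *\<^sub>R f y"
    using assms(2) by (auto simp: in_segment)
  then have p: "snd p = (1 - u) * h x + u * h y" by simp
  have "h x \<le> h y" using height_mono assms(1) .
  then have "u * (h y - h x) \<ge> 0" "(1 - u) * (h y - h x) \<ge> 0" using u by auto
  then show "h x \<le> snd p" "snd p \<le> h y" unfolding p by (auto simp: algebra_simps)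
qed

text \<open>Two edges through a common point either meet in a common endpoint, which then has height
  \<open>\<tau>\<close>, or are the same edge; in that case its two ends are shared vertices on
  either side of \<open>\<tau>\<close>. Hence there are two conclusions, for searching downwards and
  upwards.\<close>

lemma path_crossing:
  assumes "edge_path f V \<phi> s t" "\<tau> \<in> {s..t}" "edge_path f W \<psi> s' t'" "\<tau> \<in> {s'..t'}" "\<phi> \<tau> = \<psi> \<tau>"
  shows "\<exists>z\<in>V \<inter> W. h z \<le> \<tau>" "\<exists>z\<in>V \<inter> W. \<tau> \<le> h z"
proof -
  obtain u v where uv: "u \<in> V" "v \<in> V" "u = v \<or> covered_by u v" "(\<phi> \<tau>, \<tau>) \<in> closed_segment (f u) (f v)"
    using assms(1,2) unfolding edge_path_def by blast
  obtain u' v' where uv': "u' \<in> W" "v' \<in> W" "u' = v' \<or> covered_by u' v'"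
    "(\<phi> \<tau>, \<tau>) \<in> closed_segment (f u') (f v')"
    using assms(3-5) unfolding edge_path_def by metis
  have inj: "inj f"
    and on: "\<And>x y z. covered_by x y \<Longrightarrow> f z \<in> closed_segment (f x) (f y) \<Longrightarrow> z = x \<or> z = y"
    and cr: "\<And>x y x' y'. covered_by x y \<Longrightarrow> covered_by x' y' \<Longrightarrow> (x, y) \<noteq> (x', y') \<Longrightarrow>
        closed_segment (f x) (f y) \<inter> closed_segment (f x') (f y') \<subseteq> f ` ({x, y} \<inter> {x', y'})"
    using diagram unfolding planar_diagram_def by auto
  have "(\<exists>z\<in>V \<inter> W. f z = (\<phi> \<tau>, \<tau>)) \<or> (covered_by u v \<and> u = u' \<and> v = v')"
  proof -
    consider "u = v" "u' = v'" | "u = v" "covered_by u' v'" | "covered_by u v" "u' = v'"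
      | "covered_by u v" "covered_by u' v'" using uv uv' by blast
    then show ?thesis
    proof cases
      case 1
      then have "f u = (\<phi> \<tau>, \<tau>)" "f u' = (\<phi> \<tau>, \<tau>)" using uv uv' by auto
      moreover from this have "u = u'" using inj by (metis injD)
      ultimately show ?thesis using uv uv' by auto
    next
      case 2
      then have "f u = (\<phi> \<tau>, \<tau>)" using uv by auto
      moreover from this have "u = u' \<or> u = v'" using uv' 2 on[of u' v' u] by auto
      ultimately show ?thesis using uv uv' by auto
    next
      case 3
      then have "f u' = (\<phi> \<tau>, \<tau>)" using uv' by auto
      moreover from this have "u' = u \<or> u' = v" using uv 3 on[of u v u'] by auto
      ultimately show ?thesis using uv uv' by auto
    next
      case 4
      show ?thesis
      proof (cases "(u, v) = (u', v')")
        case False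
        then have "(\<phi> \<tau>, \<tau>) \<in> f ` ({u, v} \<inter> {u', v'})" using cr[OF 4] uv(4) uv'(4) by blast
        then show ?thesis using uv uv' by (elim imageE) (metis Int_iff empty_iff insert_iff)
      qed (use 4 in auto)
    qed
  qed
  then have "(\<exists>z\<in>V \<inter> W. h z \<le> \<tau>) \<and> (\<exists>z\<in>V \<inter> W. \<tau> \<le> h z)"
  proof (elim disjE bexE conjE)
    fix z assume "z \<in> V \<inter> W" "f z = (\<phi> \<tau>, \<tau>)"
    then show ?thesis by (intro conjI bexI[of _ z]) auto
  next
    assume "covered_by u v" "u = u'" "v = v'"
    then have "u \<in> V \<inter> W" "v \<in> V \<inter> W" "h u \<le> \<tau>" "\<tau> \<le> h v"
      using uv uv' height_in_segment[OF _ uv(4)] covered_byD[of u v] by auto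
    then show ?thesis by blast
  qed
  then show "\<exists>z\<in>V \<inter> W. h z \<le> \<tau>" "\<exists>z\<in>V \<inter> W. \<tau> \<le> h z" by auto
qed

lemma edge_path_edge:
  assumes "covered_by x y"
  shows "edge_path f {x, y} (\<lambda>\<tau>. g x + slope f x y * (\<tau> - h x)) (h x) (h y)"
    and "g x + slope f x y * (\<tau> - h x) = g y + slope f x y * (\<tau> - h y)"
proof -
  have lt: "h x < h y" using assms covered_byD height_less by blast
  show "g x + slope f x y * (\<tau> - h x) = g y + slope f x y * (\<tau> - h y)" for \<tau>
    using lt by (simp add: slope_def field_simps)
  show "edge_path f {x, y} (\<lambda>\<tau>. g x + slope f x y * (\<tau> - h x)) (h x) (h y)"
    unfolding edge_path_def
  proof (intro conjI ballI)
    show "continuous_on {h x..h y} (\<lambda>\<tau>. g x + slope f x y * (\<tau> - h x))"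
      by (intro continuous_intros)
    fix \<tau> assume \<tau>: "\<tau> \<in> {h x..h y}"
    define u where "u = (\<tau> - h x) / (h y - h x)"
    have "0 \<le> u" "u \<le> 1" using \<tau> lt by (auto simp: u_def field_simps)
    moreover have "\<tau> = h x + u * (h y - h x)" using lt by (simp add: u_def)
    then have "\<tau> = (1 - u) * h x + u * h y" by (simp add: algebra_simps)
    moreover have "slope f x y * (\<tau> - h x) = u * (g y - g x)"
      by (simp add: slope_def u_def)
    then have "g x + slope f x y * (\<tau> - h x) = (1 - u) * g x + u * g y"
      by (simp add: algebra_simps)
    ultimately have "(g x + slope f x y * (\<tau> - h x), \<tau>) \<in> closed_segment (f x) (f y)"
      unfolding in_segment by (intro exI[of _ u]) (simp add: prod_eq_iff)
    then show "\<exists>u\<in>{x, y}. \<exists>v\<in>{x, y}. (u = v \<or> covered_by u v) \<and>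
        (g x + slope f x y * (\<tau> - h x), \<tau>) \<in> closed_segment (f u) (f v)"
      using assms by blast
  qed
qed

lemma edge_path_exists:
  assumes "x \<le> y"
  shows "\<exists>\<phi>. edge_path f {x..y} \<phi> (h x) (h y) \<and> \<phi> (h x) = g x \<and> \<phi> (h y) = g y"
proof -
  have "covered_by\<^sup>*\<^sup>* x y" using assms by (rule covered_by_chain)
  then have "x \<le> y \<and> (\<exists>\<phi>. edge_path f {x..y} \<phi> (h x) (h y) \<and> \<phi> (h x) = g x \<and> \<phi> (h y) = g y)"
  proof (induction rule: rtranclp_induct)
    case base
    have "edge_path f {x..x} (\<lambda>_. g x) (h x) (h x)"
      by (auto simp: edge_path_def)
    then show ?case by auto
  next
    case (step y z)
    then obtain \<phi> where \<phi>: "x \<le> y" "edge_path f {x..y} \<phi> (h x) (h y)" "\<phi> (h x) = g x" "\<phi> (h y) = g y"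
      by blast
    have yz: "y < z" "h y < h z" using step(2) covered_byD height_less by blast+
    let ?\<psi> = "\<lambda>\<tau>. if \<tau> \<le> h y then \<phi> \<tau> else g y + slope f y z * (\<tau> - h y)"
    have "edge_path f ({x..y} \<union> {y, z}) ?\<psi> (h x) (h z)"
      using edge_path_join[OF \<phi>(2) edge_path_edge(1)[OF step(2)]] \<phi> yz height_mono by simp
    moreover have "{x..y} \<union> {y, z} \<subseteq> {x..z}" using \<phi>(1) yz by auto
    ultimately have "edge_path f {x..z} ?\<psi> (h x) (h z)" using edge_path_subset by blast
    moreover have "?\<psi> (h x) = g x" using \<phi> height_mono by simp
    moreover have "?\<psi> (h z) = g z" using yz edge_path_edge(2)[OF step(2), of "h z"] by simp
    ultimately show ?case using \<phi>(1) yz by (intro conjI exI[of _ ?\<psi>]) auto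
  qed
  then show ?thesis by blast
qed

text \<open>The path ends with the straight edge from \<open>x\<close> to \<open>b\<close>, so just
  below \<open>b\<close> its position relative to similar paths is decided by slopes.\<close>

lemma edge_path_to_cover:
  assumes "w \<le> x" "covered_by x b"
  shows "\<exists>\<phi>. edge_path f (insert b {w..x}) \<phi> (h w) (h b) \<and> \<phi> (h w) = g w \<and>
    (\<forall>\<tau>\<in>{h x..h b}. \<phi> \<tau> = g b + slope f x b * (\<tau> - h b))"
proof -
  obtain \<phi> where \<phi>: "edge_path f {w..x} \<phi> (h w) (h x)" "\<phi> (h w) = g w" "\<phi> (h x) = g x"
    using edge_path_exists[OF assms(1)] by blast
  have xb: "h x < h b" "h w \<le> h x" using assms covered_byD height_less height_mono by blast+
  let ?\<psi> = "\<lambda>\<tau>. if \<tau> \<le> h x then \<phi> \<tau> else g x + slope f x b * (\<tau> - h x)"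
  have "edge_path f ({w..x} \<union> {x, b}) ?\<psi> (h w) (h b)"
    using edge_path_join[OF \<phi>(1) edge_path_edge(1)[OF assms(2)]] \<phi> xb by simp
  moreover have "{w..x} \<union> {x, b} = insert b {w..x}" using assms(1) by auto
  moreover have "?\<psi> \<tau> = g b + slope f x b * (\<tau> - h b)" if "\<tau> \<in> {h x..h b}" for \<tau>
    using that edge_path_edge(2)[OF assms(2), of \<tau>] \<phi> by (cases "\<tau> = h x") auto
  moreover have "?\<psi> (h w) = g w" using \<phi> xb by simp
  ultimately show ?thesis by (intro exI[of _ ?\<psi>]) auto
qed

lemma edge_path_from_cover:
  assumes "covered_by s x" "x \<le> j"
  shows "\<exists>\<phi>. edge_path f (insert s {x..j}) \<phi> (h s) (h j) \<and> \<phi> (h j) = g j \<and>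
    (\<forall>\<tau>\<in>{h s..h x}. \<phi> \<tau> = g s + slope f s x * (\<tau> - h s))"
proof -
  obtain \<phi> where \<phi>: "edge_path f {x..j} \<phi> (h x) (h j)" "\<phi> (h x) = g x" "\<phi> (h j) = g j"
    using edge_path_exists[OF assms(2)] by blast
  have xb: "h s < h x" "h x \<le> h j" using assms covered_byD height_less height_mono by blast+
  let ?\<psi> = "\<lambda>\<tau>. if \<tau> \<le> h x then g s + slope f s x * (\<tau> - h s) else \<phi> \<tau>"
  have gx: "g s + slope f s x * (h x - h s) = g x"
    using edge_path_edge(2)[OF assms(1), of "h x"] by simp
  have "edge_path f ({s, x} \<union> {x..j}) ?\<psi> (h s) (h j)"
    using edge_path_join[OF edge_path_edge(1)[OF assms(1)] \<phi>(1)] gx \<phi> xb by simp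
  moreover have "{s, x} \<union> {x..j} = insert s {x..j}" using assms(2) by auto
  moreover have "?\<psi> (h j) = g j" using \<phi> xb gx by (cases "h j = h x") auto
  ultimately show ?thesis by (intro exI[of _ ?\<psi>]) auto
qed

subsection \<open>Consequences of planarity\<close>

text \<open>With equal slopes the two edges overlap below \<open>b\<close>. At the height of the
  higher of the two lower ends this forces a shared vertex other than \<open>b\<close>.\<close>

lemma lower_slope_inj:
  assumes "covered_by x b" "covered_by a b" "slope f x b = slope f a b"
  shows "x = a"
proof -
  define \<tau> where "\<tau> = max (h x) (h a)"
  have \<tau>: "\<tau> < h b" "\<tau> \<in> {h x..h b}" "\<tau> \<in> {h a..h b}"
    using assms covered_byD height_less by (fastforce simp: \<tau>_def)+
  have "\<exists>z\<in>{x, b} \<inter> {a, b}. h z \<le> \<tau>"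
    using path_crossing(1)[OF edge_path_edge(1)[OF assms(1)] \<tau>(2) edge_path_edge(1)[OF assms(2)] \<tau>(3)]
      edge_path_edge(2)[OF assms(1)] edge_path_edge(2)[OF assms(2)] assms(3) by simp
  then show ?thesis using \<tau>(1) by auto
qed

lemma upper_slope_inj:
  assumes "covered_by s x" "covered_by s a" "slope f s x = slope f s a"
  shows "x = a"
proof -
  define \<tau> where "\<tau> = min (h x) (h a)"
  have \<tau>: "\<tau> > h s" "\<tau> \<in> {h s..h x}" "\<tau> \<in> {h s..h a}"
    using assms covered_byD height_less by (fastforce simp: \<tau>_def)+
  have "\<exists>z\<in>{s, x} \<inter> {s, a}. \<tau> \<le> h z"
    using path_crossing(2)[OF edge_path_edge(1)[OF assms(1)] \<tau>(2) edge_path_edge(1)[OF assms(2)] \<tau>(3)]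
      assms(3) by simp
  then show ?thesis using \<tau>(1) by auto
qed

text \<open>Paths from \<open>w = inf x m\<close> to \<open>b\<close> through \<open>x\<close> and
  through \<open>m\<close> enclose a region that the edge from \<open>a\<close> enters at
  \<open>b\<close>. A path that reaches \<open>b\<close> through \<open>a\<close> from a point no
  higher than \<open>w\<close> has to enter this region, and a vertex shared with its boundary lies
  above \<open>w\<close> and below \<open>a\<close>.\<close>

lemma lower_covers_between:
  assumes cov: "covered_by x b" "covered_by a b" "covered_by m b"
    and sl: "slope f x b < slope f a b" "slope f a b < slope f m b"
  shows "inf x m \<le> a"
proof -
  define w where "w = inf x m"
  \<comment> \<open>Starting the path through \<open>a\<close> at an element below \<open>w\<close>
    makes it defined at height \<open>h w\<close>.\<close>
  define w' where "w' = inf w a"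
  have w: "w \<le> x" "w \<le> m" "w' \<le> a" "w' \<le> w" by (auto simp: w_def w'_def intro: le_infI1)
  obtain \<phi> where \<phi>: "edge_path f (insert b {w..x}) \<phi> (h w) (h b)" "\<phi> (h w) = g w"
    "\<And>\<tau>. \<tau>\<in>{h x..h b} \<Longrightarrow> \<phi> \<tau> = g b + slope f x b * (\<tau> - h b)"
    using edge_path_to_cover[OF w(1) cov(1)] by blast
  obtain \<omega> where \<omega>: "edge_path f (insert b {w..m}) \<omega> (h w) (h b)" "\<omega> (h w) = g w"
    "\<And>\<tau>. \<tau>\<in>{h m..h b} \<Longrightarrow> \<omega> \<tau> = g b + slope f m b * (\<tau> - h b)"
    using edge_path_to_cover[OF w(2) cov(3)] by blast
  obtain \<psi> where \<psi>: "edge_path f (insert b {w'..a}) \<psi> (h w') (h b)"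
    "\<And>\<tau>. \<tau>\<in>{h a..h b} \<Longrightarrow> \<psi> \<tau> = g b + slope f a b * (\<tau> - h b)"
    using edge_path_to_cover[OF w(3) cov(2)] by blast
  \<comment> \<open>At height \<open>t\<close> all three paths already run on their last edges, and
    a crossing up to this height cannot be at \<open>b\<close>.\<close>
  define t where "t = max (max (h x) (h m)) (h a)"
  have t: "t < h b" "h x \<le> t" "h m \<le> t" "h a \<le> t"
    using cov covered_byD height_less by (auto simp: t_def)
  have hw: "h w' \<le> h w" "h w \<le> t"
    using w height_mono[of w' w] height_mono[of w x] t by auto
  have "continuous_on {h w..t} \<phi>" "continuous_on {h w..t} \<omega>" "continuous_on {h w..t} \<psi>"
    using \<phi>(1) \<omega>(1) \<psi>(1) t hw by (auto simp: edge_path_def elim!: continuous_on_subset)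
  \<comment> \<open>Both outer paths start at \<open>w\<close>, so the product is minus a
    square.\<close>
  moreover have "(\<psi> (h w) - \<phi> (h w)) * (\<omega> (h w) - \<psi> (h w)) \<le> 0"
    using \<phi>(2) \<omega>(2) zero_le_square[of "\<psi> (h w) - g w"] by (simp add: algebra_simps)
  moreover have "0 \<le> (\<psi> t - \<phi> t) * (\<omega> t - \<psi> t)"
    by (rule between_lines_nonneg[OF sl \<phi>(3) \<psi>(2) \<omega>(3)]) (use t in auto)
  ultimately obtain \<tau> where \<tau>: "\<tau> \<in> {h w..t}" "\<psi> \<tau> = \<phi> \<tau> \<or> \<psi> \<tau> = \<omega> \<tau>"
    using continuous_sign_change[of "h w" t \<phi> \<psi> \<omega>] hw by blast
  have \<tau>': "\<tau> \<in> {h w..h b}" "\<tau> \<in> {h w'..h b}" using \<tau> t hw by auto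
  have "\<exists>z\<in>insert b {w'..a} \<inter> (insert b {w..x} \<union> insert b {w..m}). h z \<le> \<tau>"
    using path_crossing(1)[OF \<psi>(1) \<tau>'(2) \<phi>(1) \<tau>'(1)] path_crossing(1)[OF \<psi>(1) \<tau>'(2) \<omega>(1) \<tau>'(1)]
      \<tau>(2) by blast
  then obtain z where "z \<in> insert b {w'..a}" "z \<in> insert b {w..x} \<union> insert b {w..m}" "h z \<le> \<tau>"
    by blast
  moreover from this have "z \<noteq> b" using \<tau> t by auto
  ultimately have "w \<le> z" "z \<le> a" by auto
  then show ?thesis unfolding w_def by (rule order_trans)
qed

text \<open>The element \<open>a\<close> lies strictly inside the region bounded by the paths from
  \<open>w\<close> to \<open>b\<close> through \<open>x\<close> and \<open>m\<close>. A path from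
  \<open>a\<close> through another cover \<open>u\<close> would have to leave the region no higher
  than \<open>b\<close>, where it closes; the shared vertex would give \<open>u \<le> b\<close>,
  \<open>a \<le> x\<close> or \<open>a \<le> m\<close>.\<close>

lemma lower_cover_between_unique_cover:
  assumes cov: "covered_by x b" "covered_by a b" "covered_by m b"
    and sl: "slope f x b < slope f a b" "slope f a b < slope f m b"
    and au: "covered_by a u"
  shows "u = b"
proof (rule ccontr)
  assume ub: "u \<noteq> b"
  have nle: "\<not> u \<le> b"
    using covered_by_between[OF cov(2), of u] ub covered_byD[OF au] by (auto simp: less_le)
  define w where "w = inf x m"
  have w: "w \<le> x" "w \<le> m" "w \<le> a" using lower_covers_between[OF cov sl] by (simp_all add: w_def)
  have ax: "\<not> a \<le> x" "\<not> a \<le> m"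
    using covered_by_sup_eq(2)[OF cov(1,2)] covered_by_sup_eq(2)[OF cov(3,2)] sl by auto
  obtain \<phi> where \<phi>: "edge_path f (insert b {w..x}) \<phi> (h w) (h b)"
    "\<And>\<tau>. \<tau>\<in>{h x..h b} \<Longrightarrow> \<phi> \<tau> = g b + slope f x b * (\<tau> - h b)"
    using edge_path_to_cover[OF w(1) cov(1)] by blast
  obtain \<omega> where \<omega>: "edge_path f (insert b {w..m}) \<omega> (h w) (h b)"
    "\<And>\<tau>. \<tau>\<in>{h m..h b} \<Longrightarrow> \<omega> \<tau> = g b + slope f m b * (\<tau> - h b)"
    using edge_path_to_cover[OF w(2) cov(3)] by blast
  define \<psi> where "\<psi> \<tau> = g a + slope f a b * (\<tau> - h a)" for \<tau>
  have \<psi>: "edge_path f {a, b} \<psi> (h a) (h b)" "\<And>\<tau>. \<psi> \<tau> = g b + slope f a b * (\<tau> - h b)"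
    using edge_path_edge[OF cov(2)] unfolding \<psi>_def by auto
  define t where "t = max (max (h x) (h m)) (h a)"
  have t: "t < h b" "h x \<le> t" "h m \<le> t" "h a \<le> t"
    using cov covered_byD height_less by (auto simp: t_def)
  have hw: "h w \<le> h a" using w height_mono by auto
  \<comment> \<open>If \<open>a\<close> were not strictly inside, its edge to \<open>b\<close> would
    meet the boundary below \<open>b\<close>, necessarily with \<open>a\<close> as the shared
    vertex.\<close>
  have pos: "0 < (\<psi> (h a) - \<phi> (h a)) * (\<omega> (h a) - \<psi> (h a))"
  proof (rule ccontr)
    assume neg: "\<not> ?thesis"
    have "continuous_on {h a..t} \<phi>" "continuous_on {h a..t} \<omega>" "continuous_on {h a..t} \<psi>"
      using \<phi>(1) \<omega>(1) \<psi>(1) t hw by (auto simp: edge_path_def elim!: continuous_on_subset)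
    moreover have "0 \<le> (\<psi> t - \<phi> t) * (\<omega> t - \<psi> t)"
      by (rule between_lines_nonneg[OF sl \<phi>(2) \<psi>(2) \<omega>(2)]) (use t in auto)
    ultimately obtain \<tau> where \<tau>: "\<tau> \<in> {h a..t}" "\<psi> \<tau> = \<phi> \<tau> \<or> \<psi> \<tau> = \<omega> \<tau>"
      using continuous_sign_change[of "h a" t \<phi> \<psi> \<omega>] t neg by fastforce
    have \<tau>': "\<tau> \<in> {h w..h b}" "\<tau> \<in> {h a..h b}" using \<tau> t hw by auto
    have "\<exists>z\<in>{a, b} \<inter> (insert b {w..x} \<union> insert b {w..m}). h z \<le> \<tau>"
      using path_crossing(1)[OF \<psi>(1) \<tau>'(2) \<phi>(1) \<tau>'(1)] path_crossing(1)[OF \<psi>(1) \<tau>'(2) \<omega>(1) \<tau>'(1)]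
        \<tau>(2) by blast
    then obtain z where "z \<in> {a, b}" "z \<in> insert b {w..x} \<union> insert b {w..m}" "h z \<le> \<tau>"
      by blast
    moreover from this have "z \<noteq> b" using \<tau> t by auto
    ultimately show False using ax by auto
  qed
  \<comment> \<open>The target \<open>sup u b\<close> ensures that the path through \<open>u\<close>
    is defined up to height \<open>h b\<close>.\<close>
  obtain \<rho> where \<rho>: "edge_path f (insert a {u..sup u b}) \<rho> (h a) (h (sup u b))"
    "\<And>\<tau>. \<tau>\<in>{h a..h u} \<Longrightarrow> \<rho> \<tau> = g a + slope f a u * (\<tau> - h a)"
    using edge_path_from_cover[OF au sup_ge1[of u b]] by blast
  have hb: "h b \<le> h (sup u b)" "h a \<le> h b" "h a \<le> h u"
    using height_mono covered_byD[OF cov(2)] covered_byD[OF au] by auto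
  have "\<rho> (h a) = \<psi> (h a)" using \<rho>(2)[of "h a"] hb by (simp add: \<psi>_def)
  with pos have "0 \<le> (\<rho> (h a) - \<phi> (h a)) * (\<omega> (h a) - \<rho> (h a))" by simp
  moreover have "(\<rho> (h b) - \<phi> (h b)) * (\<omega> (h b) - \<rho> (h b)) \<le> 0"
    using \<phi>(2)[of "h b"] \<omega>(2)[of "h b"] t zero_le_square[of "\<rho> (h b) - g b"]
    by (simp add: algebra_simps)
  moreover have "continuous_on {h a..h b} \<phi>" "continuous_on {h a..h b} \<omega>" "continuous_on {h a..h b} \<rho>"
    using \<phi>(1) \<omega>(1) \<rho>(1) t hw hb by (auto simp: edge_path_def elim!: continuous_on_subset)
  ultimately obtain \<tau> where \<tau>: "\<tau> \<in> {h a..h b}" "\<rho> \<tau> = \<phi> \<tau> \<or> \<rho> \<tau> = \<omega> \<tau>"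
    using continuous_sign_change[of "h a" "h b" \<phi> \<rho> \<omega>] hb by blast
  have \<tau>': "\<tau> \<in> {h w..h b}" "\<tau> \<in> {h a..h (sup u b)}" using \<tau> hw hb by auto
  have "\<exists>z\<in>insert a {u..sup u b} \<inter> (insert b {w..x} \<union> insert b {w..m}). h z \<le> \<tau>"
    using path_crossing(1)[OF \<rho>(1) \<tau>'(2) \<phi>(1) \<tau>'(1)] path_crossing(1)[OF \<rho>(1) \<tau>'(2) \<omega>(1) \<tau>'(1)]
      \<tau>(2) by blast
  then obtain z where "z \<in> insert a {u..sup u b}" "z \<in> insert b {w..x} \<union> insert b {w..m}"
    by blast
  then have "z = a \<or> u \<le> z" "z = b \<or> z \<le> x \<or> z \<le> m" by auto
  moreover have "a \<noteq> b" "a < u" using covered_byD cov au by auto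
  ultimately have "z = b \<and> u \<le> z \<or> a \<le> x \<or> a \<le> m"
    by (meson less_imp_le order_trans order_refl)
  then show False using ax nle by auto
qed

text \<open>The order dual of \<open>lower_covers_between\<close>: the paths separate at
  \<open>s\<close>, the outer two rejoin at \<open>j\<close>, and the crossing gives a vertex above
  \<open>a\<close> and below \<open>j\<close>.\<close>

lemma upper_covers_between:
  assumes cov: "covered_by s x" "covered_by s a" "covered_by s m"
    and sl: "slope f s x < slope f s a" "slope f s a < slope f s m"
  shows "a \<le> sup x m"
proof -
  define j where "j = sup x m"
  define j' where "j' = sup a j"
  have j: "x \<le> j" "m \<le> j" "a \<le> j'" "j \<le> j'" by (auto simp: j_def j'_def)
  obtain \<phi> where \<phi>: "edge_path f (insert s {x..j}) \<phi> (h s) (h j)" "\<phi> (h j) = g j"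
    "\<And>\<tau>. \<tau>\<in>{h s..h x} \<Longrightarrow> \<phi> \<tau> = g s + slope f s x * (\<tau> - h s)"
    using edge_path_from_cover[OF cov(1) j(1)] by blast
  obtain \<omega> where \<omega>: "edge_path f (insert s {m..j}) \<omega> (h s) (h j)" "\<omega> (h j) = g j"
    "\<And>\<tau>. \<tau>\<in>{h s..h m} \<Longrightarrow> \<omega> \<tau> = g s + slope f s m * (\<tau> - h s)"
    using edge_path_from_cover[OF cov(3) j(2)] by blast
  obtain \<psi> where \<psi>: "edge_path f (insert s {a..j'}) \<psi> (h s) (h j')"
    "\<And>\<tau>. \<tau>\<in>{h s..h a} \<Longrightarrow> \<psi> \<tau> = g s + slope f s a * (\<tau> - h s)"
    using edge_path_from_cover[OF cov(2) j(3)] by blast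
  define t where "t = min (min (h x) (h m)) (h a)"
  have t: "h s < t" "t \<le> h x" "t \<le> h m" "t \<le> h a"
    using cov covered_byD height_less by (auto simp: t_def)
  have hj: "h j \<le> h j'" "t \<le> h j"
    using j height_mono[of j j'] height_mono[of x j] t by auto
  have "continuous_on {t..h j} \<phi>" "continuous_on {t..h j} \<omega>" "continuous_on {t..h j} \<psi>"
    using \<phi>(1) \<omega>(1) \<psi>(1) t hj by (auto simp: edge_path_def elim!: continuous_on_subset)
  moreover have "(\<psi> (h j) - \<phi> (h j)) * (\<omega> (h j) - \<psi> (h j)) \<le> 0"
    using \<phi>(2) \<omega>(2) zero_le_square[of "\<psi> (h j) - g j"] by (simp add: algebra_simps)
  moreover have "0 \<le> (\<psi> t - \<phi> t) * (\<omega> t - \<psi> t)"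
    by (rule between_lines_nonneg[OF sl \<phi>(3) \<psi>(2) \<omega>(3)]) (use t in auto)
  ultimately obtain \<tau> where \<tau>: "\<tau> \<in> {t..h j}" "\<psi> \<tau> = \<phi> \<tau> \<or> \<psi> \<tau> = \<omega> \<tau>"
    using continuous_sign_change[of t "h j" \<phi> \<psi> \<omega>] hj by blast
  have \<tau>': "\<tau> \<in> {h s..h j}" "\<tau> \<in> {h s..h j'}" using \<tau> t hj by auto
  have "\<exists>z\<in>insert s {a..j'} \<inter> (insert s {x..j} \<union> insert s {m..j}). \<tau> \<le> h z"
    using path_crossing(2)[OF \<psi>(1) \<tau>'(2) \<phi>(1) \<tau>'(1)] path_crossing(2)[OF \<psi>(1) \<tau>'(2) \<omega>(1) \<tau>'(1)]
      \<tau>(2) by blast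
  then obtain z where "z \<in> insert s {a..j'}" "z \<in> insert s {x..j} \<union> insert s {m..j}" "\<tau> \<le> h z"
    by blast
  moreover from this have "z \<noteq> s" using \<tau> t by auto
  ultimately have "a \<le> z" "z \<le> j" by auto
  then show ?thesis unfolding j_def by (rule order_trans)
qed

end

subsection \<open>Swings and switches\<close>

text \<open>The seven elements form S7. The distinct lower covers \<open>y\<close>, \<open>v\<close>
  of \<open>a\<close> join to \<open>a\<close>, while \<open>inf x m \<le> a\<close> makes the
  remaining meets collapse to \<open>u\<close>.\<close>

lemma swings_toI:
  fixes x a m b :: "'a::lattice"
  assumes cov: "covered_by x b" "covered_by a b" "covered_by m b"
    and ne: "x \<noteq> a" "a \<noteq> m" "x \<noteq> m"
    and y: "inf x a = y" "covered_by y a" and v: "inf a m = v" "covered_by v a"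
    and u: "inf x m = u" "u \<le> a" and yv: "y \<noteq> v"
  shows "swings_to (x, b) (a, b)"
proof -
  define S where "S = {u, y, v, x, a, m, b}"
  have pos1: "u \<le> x" "u \<le> m" "y \<le> x" "y \<le> a" "v \<le> a" "v \<le> m" "x \<le> b" "a \<le> b" "m \<le> b"
    using y v u cov[THEN covered_byD] by (auto simp: less_imp_le)
  have "u \<le> y" "u \<le> v" "y \<le> b" "v \<le> b" "u \<le> b"
    using y(1) v(1) u pos1 by (auto intro: order_trans)
  note pos = pos1 this u(2)
  have incomp: "\<not> x \<le> a" "\<not> x \<le> m" "\<not> a \<le> x" "\<not> a \<le> m" "\<not> m \<le> x" "\<not> m \<le> a"
    using covered_by_sup_eq(2) cov ne by metis+
  have "\<not> y \<le> m"
  proof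
    assume "y \<le> m"
    then have "y \<le> v" using pos v by auto
    then have "v = y \<or> v = a" using covered_by_between[OF y(2)] pos by auto
    then show False using yv pos incomp by auto
  qed
  moreover have "\<not> v \<le> x"
  proof
    assume "v \<le> x"
    then have "v \<le> y" using pos y by auto
    then have "y = v \<or> y = a" using covered_by_between[OF v(2)] pos by auto
    then show False using yv pos incomp by auto
  qed
  moreover have "\<not> b \<le> x" "\<not> b \<le> a" "\<not> b \<le> m"
    using cov covered_byD by (auto simp: less_le_not_le)
  ultimately have neg1: "\<not> y \<le> m" "\<not> v \<le> x" "\<not> b \<le> x" "\<not> b \<le> a" "\<not> b \<le> m" by auto
  have neg2: "\<not> y \<le> u" "\<not> y \<le> v" "\<not> v \<le> u" "\<not> v \<le> y" "\<not> x \<le> u" "\<not> x \<le> y" "\<not> x \<le> v"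
    "\<not> a \<le> u" "\<not> a \<le> y" "\<not> a \<le> v" "\<not> m \<le> u" "\<not> m \<le> y" "\<not> m \<le> v"
    "\<not> b \<le> u" "\<not> b \<le> y" "\<not> b \<le> v"
    using neg1 incomp pos order_trans by metis+
  note neg = neg1 neg2 incomp
  have sups: "sup x a = b" "sup a m = b" "sup x m = b" "sup y v = a" "sup x v = b" "sup m y = b"
    using covered_by_sup_eq(1) cov ne sup_eq_of_covered_by[OF cov(1), of v]
      sup_eq_of_covered_by[OF cov(3), of y] sup_eq_of_covered_by[OF y(2), of v] neg pos by auto
  \<comment> \<open>Each of these is the meet of all three of \<open>x\<close>, \<open>a\<close>,
    \<open>m\<close>.\<close>
  have "inf y v = inf (inf x m) a" "inf x v = inf (inf x m) a" "inf m y = inf (inf x m) a"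
    unfolding y(1)[symmetric] v(1)[symmetric] by (simp_all add: inf.left_commute inf.commute)
  then have infs: "inf y v = u" "inf x v = u" "inf m y = u"
    unfolding u(1) by (simp_all add: pos inf.absorb1)
  have swap: "sup a x = b" "sup m a = b" "sup m x = b" "sup v y = a" "sup v x = b" "sup y m = b"
    "inf a x = y" "inf m a = v" "inf m x = u" "inf v y = u" "inf v x = u" "inf y m = u"
    using sups infs y(1) v(1) u(1) by (simp_all add: sup.commute inf.commute)
  have sub: "sublattice S"
    unfolding sublattice_def S_def
    by (simp add: sups infs swap y(1) v(1) u(1) pos sup.absorb1 sup.absorb2 inf.absorb1 inf.absorb2)
  have gen: "S = generated_sublattice {x, a, m}"
  proof
    show "generated_sublattice {x, a, m} \<subseteq> S"
      unfolding generated_sublattice_def using sub by (auto simp: S_def)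
    show "S \<subseteq> generated_sublattice {x, a, m}"
    proof
      fix s assume s: "s \<in> S"
      have "s \<in> T" if "sublattice T" "{x, a, m} \<subseteq> T" for T
      proof -
        have "x \<in> T" "a \<in> T" "m \<in> T" using that by auto
        then have "b \<in> T" "y \<in> T" "v \<in> T" "u \<in> T"
          using that(1) sups(1) y(1) v(1) u(1) unfolding sublattice_def by metis+
        then show ?thesis using s \<open>x \<in> T\<close> \<open>a \<in> T\<close> \<open>m \<in> T\<close> by (auto simp: S_def)
      qed
      then show "s \<in> generated_sublattice {x, a, m}" by (auto simp: generated_sublattice_def)
    qed
  qed
  have iso: "isomorphic_to S s7_covers"
  proof -
    define F where "F s = (case s of S7_u \<Rightarrow> u | S7_y \<Rightarrow> y | S7_o \<Rightarrow> v | S7_x \<Rightarrow> x | S7_a \<Rightarrow> a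
      | S7_m \<Rightarrow> m | S7_i \<Rightarrow> b)" for s
    have le: "F s \<le> F t \<longleftrightarrow> s7_le s t" for s t
      by (cases s; cases t) (simp_all add: F_def pos neg)
    have "inj F"
    proof (rule injI)
      fix s t assume "F s = F t"
      then have "s7_le s t" "s7_le t s" using le[of s t] le[of t s] by auto
      then show "s = t" by (cases s; cases t) auto
    qed
    have "s \<in> {S7_u, S7_y, S7_o, S7_x, S7_a, S7_m, S7_i}" for s by (cases s) auto
    then have "UNIV = {S7_u, S7_y, S7_o, S7_x, S7_a, S7_m, S7_i}" by blast
    then have "range F = F ` {S7_u, S7_y, S7_o, S7_x, S7_a, S7_m, S7_i}" by simp
    also have "\<dots> = S" by (simp add: F_def S_def)
    finally have "range F = S" .
    with \<open>inj F\<close> show ?thesis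
      unfolding isomorphic_to_def rtrancl_s7_covers_iff bij_betw_def using le by blast
  qed
  have lt: "y < x" "y < a" "v < a" "v < m" "u < y" "u < v" "a < b" "y < b" "v < b"
    using pos neg by (auto simp: less_le_not_le)
  have "dual_atom_in S a"
    using cov(2) pos unfolding dual_atom_in_def covers_in_def S_def by (intro bexI[of _ b]) auto
  moreover have "proper_join_in S a"
    using lt sups(4) unfolding proper_join_in_def by (auto simp: S_def)
  moreover have "d = a" if d: "dual_atom_in S d" "proper_join_in S d" for d
  proof -
    obtain t where t: "t \<in> S" "\<forall>s\<in>S. s \<le> t" "covers_in S d t"
      using d(1) unfolding dual_atom_in_def by blast
    then have "b \<le> t" by (auto simp: S_def)
    then have "t = b" using t(1) neg by (auto simp: S_def)
    then have d': "d \<in> S" "d < b" "\<not> (\<exists>z\<in>S. d < z \<and> z < b)"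
      using t(3) by (auto simp: covers_in_def)
    then have "d \<in> {x, a, m}" using lt by (auto simp: S_def)
    moreover obtain r s where rs: "r \<in> S" "s \<in> S" "r < d" "s < d" "d = sup r s"
      using d(2) unfolding proper_join_in_def by blast
    moreover have "d \<noteq> x"
    proof
      assume dx: "d = x"
      have "z \<le> y" if "z \<in> S" "z < x" for z
        using that pos neg by (auto simp: S_def less_le_not_le)
      then have "x \<le> y" using rs dx by auto
      then show False using neg by simp
    qed
    moreover have "d \<noteq> m"
    proof
      assume dx: "d = m"
      have "z \<le> v" if "z \<in> S" "z < m" for z
        using that pos neg by (auto simp: S_def less_le_not_le)
      then have "m \<le> v" using rs dx by auto
      then show False using neg by simp
    qed
    ultimately show ?thesis by auto
  qed
  ultimately have "dual_atom_in S a \<and> proper_join_in S a \<and>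
      (\<forall>d. dual_atom_in S d \<and> proper_join_in S d \<longrightarrow> d = a)"
    by blast
  with iso gen cov(3) ne have "\<exists>c S. covered_by c b \<and> c \<noteq> x \<and> c \<noteq> a \<and>
      S = generated_sublattice {x, a, c} \<and> isomorphic_to S s7_covers \<and>
      dual_atom_in S a \<and> proper_join_in S a \<and>
      (\<forall>d. dual_atom_in S d \<and> proper_join_in S d \<longrightarrow> d = a)"
    by (intro exI[of _ m] exI[of _ S]) (intro conjI; blast)
  then show ?thesis
    using cov(1,2) ne(1) unfolding swings_to_def prime_interval_def fst_conv snd_conv by blast
qed

lemma covering_m3I:
  fixes z x a m b :: "'a::lattice"
  assumes low: "covered_by z x" "covered_by z a" "covered_by z m"
    and upp: "covered_by x b" "covered_by a b" "covered_by m b"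
    and ne: "x \<noteq> a" "a \<noteq> m" "x \<noteq> m"
  shows "covering_m3 {z, x, a, m, b}"
proof -
  have pos: "z \<le> x" "z \<le> a" "z \<le> m" "x \<le> b" "a \<le> b" "m \<le> b"
    using low upp covered_byD less_imp_le by metis+
  then have "z \<le> b" by (meson order_trans)
  note pos = pos this
  have lt: "z < x" "z < a" "z < m" "x < b" "a < b" "m < b"
    using low upp covered_byD by metis+
  have neg1: "\<not> x \<le> a" "\<not> x \<le> m" "\<not> a \<le> x" "\<not> a \<le> m" "\<not> m \<le> x" "\<not> m \<le> a"
    using covered_by_sup_eq(2) upp ne by metis+
  moreover have "\<not> x \<le> z" "\<not> a \<le> z" "\<not> m \<le> z" "\<not> b \<le> x" "\<not> b \<le> a" "\<not> b \<le> m"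
    using lt by (simp_all add: less_le_not_le)
  moreover from this have "\<not> b \<le> z" using pos order_trans by blast
  ultimately have neg: "\<not> x \<le> a" "\<not> x \<le> m" "\<not> a \<le> x" "\<not> a \<le> m" "\<not> m \<le> x" "\<not> m \<le> a"
    "\<not> x \<le> z" "\<not> a \<le> z" "\<not> m \<le> z" "\<not> b \<le> x" "\<not> b \<le> a" "\<not> b \<le> m" "\<not> b \<le> z" by auto
  have sups: "sup x a = b" "sup a m = b" "sup x m = b" "sup a x = b" "sup m a = b" "sup m x = b"
    using covered_by_sup_eq(1) upp ne by metis+
  have inf_z: "inf s t = z" if "covered_by z s" "z \<le> t" "\<not> s \<le> t" for s t
    using covered_by_between[OF that(1), of "inf s t"] that covered_byD[OF that(1)]
    by (metis inf.cobounded1 inf.cobounded2 le_infI less_imp_le)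
  have infs: "inf x a = z" "inf a m = z" "inf x m = z" "inf a x = z" "inf m a = z" "inf m x = z"
    using low pos neg by (simp_all add: inf_z)
  have "sublattice {z, x, a, m, b}"
    unfolding sublattice_def
    by (simp add: sups infs pos sup.absorb1 sup.absorb2 inf.absorb1 inf.absorb2)
  moreover have "isomorphic_to {z, x, a, m, b} m3_covers"
  proof -
    define F where "F s = (case s of M3_zero \<Rightarrow> z | M3_a \<Rightarrow> x | M3_b \<Rightarrow> a | M3_c \<Rightarrow> m | M3_one \<Rightarrow> b)" for s
    have le: "F s \<le> F t \<longleftrightarrow> m3_le s t" for s t
      by (cases s; cases t) (simp_all add: F_def pos neg)
    have "inj F"
    proof (rule injI)
      fix s t assume "F s = F t"
      then have "m3_le s t" "m3_le t s" using le[of s t] le[of t s] by auto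
      then show "s = t" by (cases s; cases t) auto
    qed
    have "s \<in> {M3_zero, M3_a, M3_b, M3_c, M3_one}" for s by (cases s) auto
    then have "UNIV = {M3_zero, M3_a, M3_b, M3_c, M3_one}" by blast
    then have "range F = F ` {M3_zero, M3_a, M3_b, M3_c, M3_one}" by simp
    also have "\<dots> = {z, x, a, m, b}" by (simp add: F_def)
    finally have "range F = {z, x, a, m, b}" .
    with \<open>inj F\<close> show ?thesis
      unfolding isomorphic_to_def rtrancl_m3_covers_iff bij_betw_def using le by blast
  qed
  moreover have "covered_by s t" if c: "covers_in {z, x, a, m, b} s t" for s t
  proof -
    have st: "s \<in> {z, x, a, m, b}" "t \<in> {z, x, a, m, b}" "s \<le> t" "s \<noteq> t" "\<not> (s < x \<and> x < t)"
      using c by (auto simp: covers_in_def)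
    then show ?thesis using low upp neg lt by auto
  qed
  ultimately show ?thesis by (simp add: covering_m3_def)
qed

text \<open>A map \<open>\<sigma>\<close> placing the lower covers of \<open>b\<close> from left to right. The negation of such a map is
  another one, so left-right symmetric arguments need to be given only once.\<close>

definition left_right_position :: "'a::lattice \<Rightarrow> ('a \<Rightarrow> real) \<Rightarrow> bool" where
  "left_right_position b \<sigma> \<longleftrightarrow> inj_on \<sigma> {x. covered_by x b} \<and>
     (\<forall>x a m. covered_by x b \<longrightarrow> covered_by a b \<longrightarrow> covered_by m b \<longrightarrow>
        \<sigma> x < \<sigma> a \<longrightarrow> \<sigma> a < \<sigma> m \<longrightarrow> inf x m \<le> a)"

lemma left_right_position_uminus:
  assumes "left_right_position b \<sigma>"
  shows "left_right_position b (\<lambda>x. - \<sigma> x)"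
  unfolding left_right_position_def
proof (intro conjI allI impI)
  show "inj_on (\<lambda>x. - \<sigma> x) {x. covered_by x b}"
    using assms by (simp add: left_right_position_def inj_on_def)
  fix x a m assume "covered_by x b" "covered_by a b" "covered_by m b" "- \<sigma> x < - \<sigma> a" "- \<sigma> a < - \<sigma> m"
  then have "inf m x \<le> a" using assms by (simp add: left_right_position_def)
  then show "inf x m \<le> a" by (simp add: inf.commute)
qed

text \<open>Choose covers \<open>u \<le> a\<close> and \<open>v \<le> c\<close> of
  \<open>d = inf a c\<close>. By semimodularity \<open>sup u v\<close> covers both. If it is
  \<open>b\<close>, then \<open>u = a\<close> and \<open>v = c\<close>.\<close>

lemma adjacent_lower_covers:
  fixes b :: "'a::{finite, lattice}"
  assumes sm: "upper_semimodular TYPE('a)" and pos: "left_right_position b \<sigma>"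
    and cov: "covered_by a b" "covered_by c b" and ac: "\<sigma> a < \<sigma> c"
    and adj: "\<And>e. covered_by e b \<Longrightarrow> \<not> (\<sigma> a < \<sigma> e \<and> \<sigma> e < \<sigma> c)"
  shows "covered_by (inf a c) a" "covered_by (inf a c) c"
proof -
  define d where "d = inf a c"
  have "a \<noteq> c" using ac by auto
  then have nle: "\<not> a \<le> c" "\<not> c \<le> a" using covered_by_sup_eq(2) cov by metis+
  then have "d < a" "d < c" by (auto simp: d_def less_le_not_le)
  then obtain u v where u: "covered_by d u" "u \<le> a" and v: "covered_by d v" "v \<le> c"
    using ex_upper_cover by meson
  have "\<not> u \<le> c"
  proof
    assume "u \<le> c"
    then have "u \<le> d" using u by (simp add: d_def)
    then show False using covered_byD[OF u(1)] by auto
  qed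
  have "\<not> v \<le> a"
  proof
    assume "v \<le> a"
    then have "v \<le> d" using v by (simp add: d_def)
    then show False using covered_byD[OF v(1)] by auto
  qed
  have "sup u v \<le> b" using u v cov covered_byD by (meson le_supI less_imp_le order_trans)
  have cu: "covered_by u (sup v u)" "covered_by v (sup u v)"
    using semimodular_covered_by[OF sm v(1), of u] semimodular_covered_by[OF sm u(1), of v]
      u v \<open>\<not> u \<le> c\<close> \<open>\<not> v \<le> a\<close> covered_byD by (meson less_imp_le order_trans)+
  have "sup u v = b"
  proof (rule ccontr)
    assume "sup u v \<noteq> b"
    then have "sup u v < b" using \<open>sup u v \<le> b\<close> by (simp add: less_le)
    \<comment> \<open>By adjacency \<open>e\<close> is not between \<open>a\<close> and
      \<open>c\<close>. If \<open>a\<close> is between \<open>e\<close> and \<open>c\<close>, then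
      \<open>v \<le> inf e c \<le> a\<close>, which is false; the other side is symmetric.\<close>
    then obtain e where e: "covered_by e b" "sup u v \<le> e" using ex_lower_cover by blast
    then have "e \<noteq> a" "e \<noteq> c" using \<open>\<not> u \<le> c\<close> \<open>\<not> v \<le> a\<close> by auto
    then have "\<sigma> e \<noteq> \<sigma> a" "\<sigma> e \<noteq> \<sigma> c"
      using pos cov e unfolding left_right_position_def inj_on_def by auto
    then consider "\<sigma> e < \<sigma> a" | "\<sigma> c < \<sigma> e" using adj[OF e(1)] by linarith
    then show False
    proof cases
      case 1
      then have "inf e c \<le> a" using pos cov e ac unfolding left_right_position_def by blast
      moreover have "v \<le> inf e c" using e v by simp
      ultimately show False using \<open>\<not> v \<le> a\<close> order_trans by blast
    next
      case 2
      then have "inf a e \<le> c" using pos cov e ac unfolding left_right_position_def by blast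
      moreover have "u \<le> inf a e" using e u by simp
      ultimately show False using \<open>\<not> u \<le> c\<close> order_trans by blast
    qed
  qed
  then have "covered_by u b" "covered_by v b" using cu by (simp_all add: sup.commute)
  then have "u = a" "v = c"
    using covered_by_between[of u b a] covered_by_between[of v b c] u v cov covered_byD
    by (auto simp: less_le)
  then show "covered_by (inf a c) a" "covered_by (inf a c) c" using u v by (simp_all add: d_def)
qed

text \<open>Adjacency makes \<open>inf x a\<close> and \<open>inf a m\<close> lower covers of
  \<open>a\<close>. If they differ, an S7 arises; if they coincide, a covering M3.\<close>

lemma swing_or_switch_to_neighbour:
  fixes b :: "'a::{finite, lattice}"
  assumes sm: "upper_semimodular TYPE('a)" and pos: "left_right_position b \<sigma>"
    and cov: "covered_by x b" "covered_by a b" "covered_by m b"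
    and xam: "\<sigma> x < \<sigma> a" "\<sigma> a < \<sigma> m"
    and adj: "\<And>e. covered_by e b \<Longrightarrow> \<not> (\<sigma> x < \<sigma> e \<and> \<sigma> e < \<sigma> a)"
      "\<And>e. covered_by e b \<Longrightarrow> \<not> (\<sigma> a < \<sigma> e \<and> \<sigma> e < \<sigma> m)"
  shows "swings_to (x, b) (a, b) \<or> switches_to (x, b) (a, b)"
proof -
  have ne: "x \<noteq> a" "a \<noteq> m" "x \<noteq> m" using xam by auto
  note low = adjacent_lower_covers[OF sm pos cov(1,2) xam(1) adj(1)]
    adjacent_lower_covers[OF sm pos cov(2,3) xam(2) adj(2)]
  have xm: "inf x m \<le> a" using pos cov xam unfolding left_right_position_def by blast
  show ?thesis
  proof (cases "inf x a = inf a m")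
    case False
    then show ?thesis using swings_toI[OF cov ne refl low(2) refl low(3) refl xm] by blast
  next
    case True
    then have "covering_m3 {inf x a, x, a, m, b}"
      using covering_m3I[of "inf x a" x a m b] low cov ne by simp
    then have "switches_to (x, b) (a, b)"
      using cov ne unfolding switches_to_def prime_interval_def by auto
    then show ?thesis ..
  qed
qed

subsection \<open>Reachability\<close>

definition down_or_swing :: "'a::lattice \<times> 'a \<Rightarrow> 'a \<times> 'a \<Rightarrow> bool" where
  "down_or_swing p q \<longleftrightarrow>
     prime_interval p \<and> prime_interval q \<and> (down_perspective p q \<or> swings_to p q)"

text \<open>SPS projectivity restricted to prime intervals; the case of equal intervals is included
  because perspectivity is reflexive on them.\<close>

definition up_then_descend :: "'a::lattice \<times> 'a \<Rightarrow> 'a \<times> 'a \<Rightarrow> bool" where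
  "up_then_descend p q \<longleftrightarrow> prime_interval p \<and>
     (\<exists>r. prime_interval r \<and> up_perspective p r \<and> down_or_swing\<^sup>*\<^sup>* r q)"

definition reach :: "'a::lattice \<times> 'a \<Rightarrow> 'a \<times> 'a \<Rightarrow> bool" where
  "reach p q \<longleftrightarrow> ((up_then_descend OO switches_to)\<^sup>*\<^sup>* OO up_then_descend) p q"

lemma up_then_descend_refl: "prime_interval p \<Longrightarrow> up_then_descend p p"
  unfolding up_then_descend_def up_perspective_def using down_perspective_refl by blast

lemma up_then_descend_prime: "up_then_descend p q \<Longrightarrow> prime_interval q"
  unfolding up_then_descend_def by (auto simp: down_or_swing_def elim: rtranclp.cases)

lemma reach_refl: "prime_interval p \<Longrightarrow> reach p p"
  unfolding reach_def using up_then_descend_refl by blast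

lemma reach_prime: "reach p q \<Longrightarrow> prime_interval q"
  unfolding reach_def using up_then_descend_prime by blast

lemma reach_step:
  assumes "reach p q" "down_or_swing q r"
  shows "reach p r"
proof -
  obtain s where s: "(up_then_descend OO switches_to)\<^sup>*\<^sup>* p s" "up_then_descend s q"
    using assms(1) by (auto simp: reach_def)
  then have "up_then_descend s r"
    using assms(2) unfolding up_then_descend_def by (meson rtranclp.rtrancl_into_rtrancl)
  then show ?thesis using s(1) by (auto simp: reach_def)
qed

lemma reach_switch:
  assumes "reach p q" "switches_to q r"
  shows "reach p r"
proof -
  obtain s where s: "(up_then_descend OO switches_to)\<^sup>*\<^sup>* p s" "up_then_descend s q"
    using assms(1) by (auto simp: reach_def)
  then have "(up_then_descend OO switches_to)\<^sup>*\<^sup>* p r"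
    using assms(2) by (meson relcomppI rtranclp.rtrancl_into_rtrancl)
  moreover have "up_then_descend r r"
    using assms(2) up_then_descend_refl[of r] by (simp add: switches_to_def)
  ultimately show ?thesis by (auto simp: reach_def)
qed

section \<open>Passage between reachability, sequences and collapsing\<close>

lemma reach_imp_sequences:
  assumes "reach p q"
  shows "\<exists>(n::nat) P Q. P 0 = p \<and> Q n = q \<and>
    (\<forall>k\<le>n. prime_interval (P k) \<and> prime_interval (Q k) \<and> sps_projective (P k) (Q k)) \<and>
    (\<forall>k<n. switches_to (Q k) (P (Suc k)))"
proof -
  have sps: "prime_interval r \<and> prime_interval s \<and> sps_projective r s" if rs: "up_then_descend r s" for r s :: "'a \<times> 'a"
  proof (intro conjI)
    show "prime_interval r" using rs by (simp add: up_then_descend_def)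
    show "prime_interval s" using rs by (rule up_then_descend_prime)
    obtain t where t: "prime_interval t" "up_perspective r t" "down_or_swing\<^sup>*\<^sup>* t s"
      using rs unfolding up_then_descend_def by blast
    then obtain n where "(down_or_swing ^^ n) t s" using rtranclp_power by metis
    then obtain R where R: "R 0 = t" "R n = s" "\<forall>i<n. down_or_swing (R i) (R (Suc i))"
      using relpowp_fun_conv by metis
    have "prime_interval (R k)" if "k \<le> n" for k
    proof (cases k)
      case 0
      then show ?thesis using t R by simp
    next
      case (Suc j)
      then show ?thesis using R(3) that by (auto simp: down_or_swing_def)
    qed
    then show "sps_projective r s"
      using t R unfolding sps_projective_def down_or_swing_def by blast
  qed
  obtain r where r: "(up_then_descend OO switches_to)\<^sup>*\<^sup>* p r" "up_then_descend r q"
    using assms by (auto simp: reach_def)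
  then obtain n where "((up_then_descend OO switches_to) ^^ n) p r" using rtranclp_power by metis
  then obtain P where P: "P 0 = p" "P n = r" "\<forall>i<n. (up_then_descend OO switches_to) (P i) (P (Suc i))"
    using relpowp_fun_conv by metis
  then have "\<forall>i. \<exists>s. i < n \<longrightarrow> up_then_descend (P i) s \<and> switches_to s (P (Suc i))" by blast
  then obtain Q where Q: "\<And>i. i < n \<Longrightarrow> up_then_descend (P i) (Q i) \<and> switches_to (Q i) (P (Suc i))"
    by metis
  \<comment> \<open>The choice of \<open>Q\<close> says nothing at index \<open>n\<close>, where no
    switch follows; the final interval is inserted there.\<close>
  define Q' where "Q' = Q(n := q)"
  have "up_then_descend (P k) (Q' k)" if "k \<le> n" for k
    using that Q r(2) P(2) by (cases "k = n") (simp_all add: Q'_def)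
  then have "\<forall>k\<le>n. prime_interval (P k) \<and> prime_interval (Q' k) \<and> sps_projective (P k) (Q' k)"
    using sps by blast
  moreover have "\<forall>k<n. switches_to (Q' k) (P (Suc k))" "Q' n = q"
    using Q by (simp_all add: Q'_def)
  ultimately show ?thesis using P(1) by blast
qed

lemma collapsed_by_sps_projective:
  assumes \<theta>: "lattice_congruence \<theta>" and "sps_projective p q" "collapsed_by p \<theta>"
  shows "collapsed_by q \<theta>"
proof (cases "p = q")
  case False
  then obtain r n R where r: "up_perspective p r" and R: "R 0 = r" "R (n::nat) = q"
    "\<And>k. k < n \<Longrightarrow> down_perspective (R k) (R (Suc k)) \<or> swings_to (R k) (R (Suc k))"
    using assms(2) unfolding sps_projective_def by auto
  have "collapsed_by r \<theta>"
    using assms(3) r collapsed_by_down_perspective[OF \<theta>, of r p] by (simp add: up_perspective_def)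
  have "collapsed_by (R k) \<theta>" if "k \<le> n" for k
    using that
  proof (induction k)
    case 0
    then show ?case using R(1) \<open>collapsed_by r \<theta>\<close> by simp
  next
    case (Suc k)
    then show ?case
      using R(3)[of k] collapsed_by_down_perspective[OF \<theta>, of "R k" "R (Suc k)"]
        collapsed_by_swing[OF \<theta>, of "R k" "R (Suc k)"] by auto
  qed
  then show ?thesis using R(2) by blast
qed (use assms in simp)

lemma collapsed_by_sequences:
  assumes \<theta>: "lattice_congruence \<theta>" and "collapsed_by (P 0) \<theta>"
    and PQ: "\<And>k. k \<le> n \<Longrightarrow> sps_projective (P k) (Q k)"
    and sw: "\<And>k. k < n \<Longrightarrow> switches_to (Q k) (P (Suc k))"
  shows "collapsed_by (Q n) \<theta>"
proof -
  have "collapsed_by (P k) \<theta>" if "k \<le> n" for k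
    using that
  proof (induction k)
    case 0
    then show ?case using assms(2) by simp
  next
    case (Suc k)
    then show ?case
      using collapsed_by_switch[OF \<theta> sw[of k]] collapsed_by_sps_projective[OF \<theta> PQ[of k]] by simp
  qed
  then show ?thesis using collapsed_by_sps_projective[OF \<theta> PQ[of n]] by simp
qed

section \<open>Closure of reachability under up-perspectivity\<close>

locale planar_semimodular_lattice = planar_lattice f
  for f :: "'a::{finite, lattice} \<Rightarrow> real \<times> real" +
  assumes semimodular: "upper_semimodular TYPE('a)"
begin

lemma left_right_position_slope: "left_right_position (b :: 'a) (\<lambda>x. slope f x b)"
  unfolding left_right_position_def inj_on_def
  using lower_slope_inj lower_covers_between by blast

text \<open>The conditions on meets, as supplied by a swing, exclude by
  \<open>lower_covers_between\<close> every order of the slopes in which \<open>x\<close> or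
  \<open>c\<close> is in the middle, so \<open>a\<close> is.\<close>

lemma middle_unique_cover:
  fixes x a b c u :: 'a
  assumes cov: "covered_by x b" "covered_by a b" "covered_by c b"
    and ne: "x \<noteq> a" "c \<noteq> x" "c \<noteq> a"
    and mid: "\<not> inf x a \<le> c" "\<not> inf a c \<le> x" and au: "covered_by a u"
  shows "u = b"
proof -
  have "slope f x b \<noteq> slope f a b" "slope f c b \<noteq> slope f x b" "slope f c b \<noteq> slope f a b"
    using lower_slope_inj cov ne by metis+
  then consider "slope f x b < slope f a b" "slope f a b < slope f c b"
    | "slope f c b < slope f a b" "slope f a b < slope f x b"
    | "slope f a b < slope f x b" "slope f x b < slope f c b"
    | "slope f c b < slope f x b" "slope f x b < slope f a b"
    | "slope f x b < slope f c b" "slope f c b < slope f a b"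
    | "slope f a b < slope f c b" "slope f c b < slope f x b" by linarith
  then show ?thesis
  proof cases
    case 1
    then show ?thesis using lower_cover_between_unique_cover[OF cov] au by blast
  next
    case 2
    then show ?thesis using lower_cover_between_unique_cover[OF cov(3,2,1)] au by blast
  next
    case 3
    then show ?thesis using lower_covers_between[OF cov(2,1,3)] mid by blast
  next
    case 4
    then show ?thesis using lower_covers_between[OF cov(3,1,2)] mid by (simp add: inf.commute)
  next
    case 5
    then show ?thesis using lower_covers_between[OF cov(1,3,2)] mid by blast
  next
    case 6
    then show ?thesis using lower_covers_between[OF cov(2,3,1)] mid by (simp add: inf.commute)
  qed
qed

text \<open>By planarity one of the three is below the join of the other two.\<close>

lemma three_upper_covers:
  fixes s x a m :: 'a
  assumes cov: "covered_by s x" "covered_by s a" "covered_by s m"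
    and ne: "x \<noteq> a" "a \<noteq> m" "x \<noteq> m"
  shows "sup x a = sup a m"
proof -
  have nle: "\<not> y \<le> z" if "covered_by s y" "covered_by s z" "y \<noteq> z" for y z
    using covered_by_between[OF that(2), of y] that covered_byD by (auto simp: less_le)
  have cj: "covered_by y (sup y z)" if "covered_by s y" "covered_by s z" "y \<noteq> z" for y z
    using semimodular_covered_by[OF semimodular that(2), of y] nle[of z y] that covered_byD[OF that(1)]
    by (simp add: sup.commute less_imp_le)
  \<comment> \<open>The element \<open>sup y z\<close> is strictly above \<open>y\<close> and at
    most \<open>sup y w\<close>, which covers \<open>y\<close> by semimodularity; the argument at
    \<open>w\<close> is the same.\<close>
  have *: "sup y z = sup y w \<and> sup z w = sup y w"
    if yzw: "covered_by s y" "covered_by s z" "covered_by s w" "y \<noteq> z" "y \<noteq> w" "z \<noteq> w"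
      and "z \<le> sup y w" for y z w
  proof
    have "sup y z \<le> sup y w" "sup z w \<le> sup y w" using \<open>z \<le> sup y w\<close> by auto
    moreover have "sup y z \<noteq> y" "sup z w \<noteq> w"
      using nle[of z y] nle[of z w] yzw by (metis sup.cobounded2, metis sup.cobounded1)
    moreover have "covered_by y (sup y w)" "covered_by w (sup y w)"
      using cj[of y w] cj[of w y] yzw by (simp_all add: sup.commute)
    ultimately show "sup y z = sup y w" "sup z w = sup y w"
      using covered_by_between[of y "sup y w" "sup y z"] covered_by_between[of w "sup y w" "sup z w"]
      by auto
  qed
  have "slope f s x \<noteq> slope f s a" "slope f s m \<noteq> slope f s x" "slope f s m \<noteq> slope f s a"
    using upper_slope_inj cov ne by metis+
  then consider "slope f s x < slope f s a" "slope f s a < slope f s m"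
    | "slope f s m < slope f s a" "slope f s a < slope f s x"
    | "slope f s a < slope f s x" "slope f s x < slope f s m"
    | "slope f s m < slope f s x" "slope f s x < slope f s a"
    | "slope f s x < slope f s m" "slope f s m < slope f s a"
    | "slope f s a < slope f s m" "slope f s m < slope f s x" by linarith
  then have "a \<le> sup x m \<or> x \<le> sup a m \<or> m \<le> sup x a"
    using upper_covers_between cov by cases (metis sup.commute)+
  then show ?thesis
  proof (elim disjE)
    assume "a \<le> sup x m"
    then show ?thesis using *[of x a m] cov ne by simp
  next
    assume "x \<le> sup a m"
    then show ?thesis using *[of a x m] cov ne by (simp add: sup.commute)
  next
    assume "m \<le> sup x a"
    then show ?thesis using *[of x m a] cov ne by (simp add: sup.commute)
  qed
qed

text \<open>A swing ends in \<open>(a, b)\<close> with \<open>b\<close> the only upper cover of \<open>a\<close>, so it cannot be followed by a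
  proper up-perspectivity; and a down-perspectivity followed by an up-perspectivity either is again a
  down-perspectivity or passes through a covering \<open>M\<^sub>3\<close>.\<close>

lemma reach_up_cover:
  fixes p q :: "'a \<times> 'a"
  assumes "reach p q" "covered_by (fst q) u" "u \<noteq> snd q"
  shows "reach p (u, sup (snd q) u)"
proof -
  obtain r where r: "(up_then_descend OO switches_to)\<^sup>*\<^sup>* p r" "up_then_descend r q"
    using assms(1) by (auto simp: reach_def)
  then obtain r0 where r0: "prime_interval r" "prime_interval r0" "up_perspective r r0"
    "down_or_swing\<^sup>*\<^sup>* r0 q" by (auto simp: up_then_descend_def)
  have up: "prime_interval (u, sup t u) \<and> down_perspective (u, sup t u) (s, t)"
    if st: "covered_by s t" "covered_by s u" "u \<noteq> t" for s t u :: 'a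
  proof
    have "\<not> t \<le> u"
      using covered_by_between[OF st(2), of t] st covered_byD[OF st(1)] by (auto simp: less_le)
    then show "prime_interval (u, sup t u)"
      using semimodular_covered_by[OF semimodular st(1), of u] covered_byD[OF st(2)]
      by (simp add: prime_interval_def)
    have "inf u t = s"
      using covered_by_between[OF st(1), of "inf u t"] \<open>\<not> t \<le> u\<close> covered_byD[OF st(1)] covered_byD[OF st(2)]
      by (metis inf.cobounded1 inf.cobounded2 le_infI less_imp_le)
    then show "down_perspective (u, sup t u) (s, t)"
      by (simp add: down_perspective_iff sup.commute sup.left_commute)
  qed
  have "\<forall>u. covered_by (fst q) u \<longrightarrow> u \<noteq> snd q \<longrightarrow> reach p (u, sup (snd q) u)"
    using r0(4)
  proof (induction rule: rtranclp_induct)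
    case base
    show ?case
    proof (intro allI impI)
      fix u assume u: "covered_by (fst r0) u" "u \<noteq> snd r0"
      then have *: "prime_interval (u, sup (snd r0) u)" "down_perspective (u, sup (snd r0) u) r0"
        using up[of "fst r0" "snd r0" u] r0(2) by (simp_all add: prime_interval_def)
      \<comment> \<open>Two consecutive up-perspectivities merge into one, followed by a descent of
        length zero.\<close>
      then have "up_perspective r (u, sup (snd r0) u)"
        using r0(3) down_perspective_trans unfolding up_perspective_def by blast
      then have "up_then_descend r (u, sup (snd r0) u)"
        using *(1) r0(1) unfolding up_then_descend_def by blast
      then show "reach p (u, sup (snd r0) u)" using r(1) by (auto simp: reach_def)
    qed
  next
    case (step q1 q2)
    obtain a b s t where [simp]: "q1 = (a, b)" "q2 = (s, t)" by (metis surj_pair)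
    have ab: "covered_by a b" and st: "covered_by s t"
      using step(2) by (auto simp: down_or_swing_def prime_interval_def)
    have "up_then_descend r q1" using r0(1-3) step(1) unfolding up_then_descend_def by blast
    then have q1: "reach p (a, b)" using r(1) by (auto simp: reach_def)
    have "reach p (u, sup t u)" if u: "covered_by s u" "u \<noteq> t" for u
      using step(2) unfolding down_or_swing_def
    proof (elim conjE disjE)
      assume sw: "swings_to q1 q2"
      then obtain c where c: "covered_by c b" "covered_by a b" "covered_by s b"
        "a \<noteq> s" "c \<noteq> a" "c \<noteq> s" "\<not> inf a s \<le> c" "\<not> inf s c \<le> a"
        by (auto elim!: swings_toE)
      have "u = b" using middle_unique_cover[OF c(2,3,1,4,5,6,7,8) u(1)] .
      moreover have "b = t" using sw by (simp add: swings_to_def)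
      ultimately show ?thesis using u(2) by simp
    next
      assume "down_perspective q1 q2"
      then have dn: "sup a t = b" "inf a t = s" by (simp_all add: down_perspective_iff)
      \<comment> \<open>For a cover \<open>w\<close> of \<open>s\<close> below \<open>a\<close>, the
        interval \<open>(w, sup t w)\<close> is itself down perspective from
        \<open>(a, b)\<close>.\<close>
      have down: "reach p (w, sup t w)" if w: "covered_by s w" "w \<noteq> t" "w \<le> a" for w
      proof -
        have *: "covered_by w (sup t w)"
          using up[OF st w(1,2)] by (simp add: prime_interval_def)
        have "\<not> t \<le> a" using dn(2) covered_byD[OF st] by (metis inf.absorb2 order_less_irrefl)
        then have "inf a (sup t w) \<noteq> sup t w" by (metis inf.cobounded1 le_sup_iff)
        then have "inf a (sup t w) = w"
          using covered_by_between[OF *, of "inf a (sup t w)"] w(3) by auto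
        moreover have "sup a (sup t w) = b" using dn(1) w(3) by (metis sup.absorb1 sup.assoc sup.commute)
        ultimately have "down_or_swing (a, b) (w, sup t w)"
          using * ab by (simp add: down_or_swing_def prime_interval_def down_perspective_iff)
        then show ?thesis using q1 reach_step by blast
      qed
      show ?thesis
      proof (cases "u \<le> a")
        case True
        then show ?thesis using down u by blast
      next
        case False
        have "s \<le> a" using dn(2) by auto
        show ?thesis
        proof (cases "s = a")
          case True
          \<comment> \<open>Here \<open>q2\<close> equals \<open>q1\<close>, so the induction
            hypothesis applies.\<close>
          then have "t = b" using dn(1) covered_byD[OF st] by (simp add: sup.absorb2)
          then show ?thesis using step.IH u True by simp
        next
          case False
          then obtain w where w: "covered_by s w" "w \<le> a"
            using ex_upper_cover[of s a] \<open>s \<le> a\<close> by (auto simp: less_le)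
          have "w \<noteq> t" using w(2) dn(2) covered_byD[OF st] by (metis inf.absorb2 order_less_irrefl)
          have "w \<noteq> u" using w(2) \<open>\<not> u \<le> a\<close> by auto
          \<comment> \<open>The covers \<open>w\<close>, \<open>u\<close>, \<open>t\<close> of
            \<open>s\<close> have the common join \<open>b'\<close> and form a covering M3. The
            interval over \<open>w\<close> is reached by going down from \<open>(a, b)\<close>, and
            it switches to the one over \<open>u\<close>.\<close>
          define b' where "b' = sup t w"
          have b': "sup t u = b'" "sup u w = b'"
            using three_upper_covers[of s u t w] three_upper_covers[of s t w u] st u w \<open>w \<noteq> t\<close> \<open>w \<noteq> u\<close>
            by (auto simp: b'_def sup.commute)
          have cov: "covered_by w b'" "covered_by u b'" "covered_by t b'"
            using up[of s t w] up[of s t u] up[of s u t] st u w \<open>w \<noteq> t\<close> b'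
            by (auto simp: prime_interval_def b'_def sup.commute)
          have "covering_m3 {s, w, u, t, b'}"
            using covering_m3I[OF w(1) u(1) st cov \<open>w \<noteq> u\<close> u(2) \<open>w \<noteq> t\<close>] .
          then have "switches_to (w, b') (u, b')"
            using cov \<open>w \<noteq> u\<close> unfolding switches_to_def prime_interval_def by auto
          moreover have "reach p (w, b')" using down w \<open>w \<noteq> t\<close> by (simp add: b'_def)
          ultimately show ?thesis using reach_switch unfolding b'(1) by blast
        qed
      qed
    qed
    then show ?case by simp
  qed
  then show ?thesis using assms by blast
qed

text \<open>\<open>reach_up_cover\<close> is repeated along a chain of covers from \<open>s\<close>
  to \<open>u\<close>; the next element \<open>z\<close> is never \<open>sup t y\<close>, as
  \<open>t\<close> is not below \<open>z\<close>.\<close>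

lemma reach_up:
  fixes p :: "'a \<times> 'a"
  assumes "reach p (s, t)" "s \<le> u" "\<not> t \<le> u"
  shows "reach p (u, sup t u)"
proof -
  have "covered_by\<^sup>*\<^sup>* s u" using assms(2) by (rule covered_by_chain)
  then have "\<not> t \<le> u \<longrightarrow> reach p (u, sup t u)"
  proof (induction rule: rtranclp_induct)
    case base
    have "s \<le> t" using reach_prime[OF assms(1)] covered_byD[of s t] by (simp add: prime_interval_def)
    then show ?case using assms(1) by (simp add: sup.absorb1)
  next
    case (step y z)
    show ?case
    proof
      assume tz: "\<not> t \<le> z"
      have yz: "y \<le> z" using covered_byD[OF step(2)] by simp
      then have "reach p (y, sup t y)" using step.IH tz by (meson order_trans)
      moreover have "z \<noteq> sup t y" using tz by auto
      ultimately have "reach p (z, sup (sup t y) z)"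
        using reach_up_cover[of p "(y, sup t y)" z] step(2) by simp
      then show "reach p (z, sup t z)" using yz by (simp add: sup.assoc sup.absorb2)
    qed
  qed
  then show ?thesis using assms(3) by blast
qed

section \<open>Join-irreducibles below the top of a reached interval\<close>

lemma reach_neighbour:
  fixes p :: "'a \<times> 'a"
  assumes pos: "left_right_position b \<sigma>" and cov: "covered_by a b" "covered_by c b"
    and ac: "\<sigma> a < \<sigma> c" and r: "reach p (a, b)"
  shows "\<exists>e. covered_by e b \<and> \<sigma> a \<le> \<sigma> e \<and> \<sigma> e < \<sigma> c \<and> reach p (inf e c, c)"
proof -
  \<comment> \<open>Consider the first \<open>e\<close> from \<open>a\<close> towards
    \<open>c\<close> for which this fails. Its predecessor \<open>x\<close> gives a reached
    interval, and \<open>e\<close> also has a successor because \<open>c\<close> comes later, so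
    \<open>(x, b)\<close> swings or switches to \<open>(e, b)\<close>.\<close>
  have all: "reach p (e, b)" if e: "covered_by e b" "\<sigma> a \<le> \<sigma> e" "\<sigma> e < \<sigma> c" for e
  proof (rule ccontr)
    assume neg: "\<not> reach p (e, b)"
    define B where "B = {e. covered_by e b \<and> \<sigma> a \<le> \<sigma> e \<and> \<sigma> e < \<sigma> c \<and> \<not> reach p (e, b)}"
    have "finite B" "B \<noteq> {}" using e neg by (auto simp: B_def)
    then obtain e where e: "e \<in> B" "\<And>z. z \<in> B \<Longrightarrow> \<not> \<sigma> z < \<sigma> e"
      using arg_min_if_finite[of B \<sigma>] by blast
    then have "e \<noteq> a" using r by (auto simp: B_def)
    then have ae: "\<sigma> a < \<sigma> e"
      using e(1) pos cov(1) unfolding left_right_position_def inj_on_def B_def by (auto simp: less_le)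
    define L where "L = {x. covered_by x b \<and> \<sigma> x < \<sigma> e}"
    define R where "R = {x. covered_by x b \<and> \<sigma> e < \<sigma> x}"
    have "finite L" "L \<noteq> {}" "finite R" "R \<noteq> {}"
      using ae cov e(1) by (auto simp: L_def R_def B_def)
    then obtain x m where x: "x \<in> L" "\<And>z. z \<in> L \<Longrightarrow> \<not> - \<sigma> z < - \<sigma> x"
      and m: "m \<in> R" "\<And>z. z \<in> R \<Longrightarrow> \<not> \<sigma> z < \<sigma> m"
      using arg_min_if_finite[of L "\<lambda>z. - \<sigma> z"] arg_min_if_finite[of R \<sigma>] by metis
    have "a \<in> L" using ae cov by (simp add: L_def)
    then have "\<sigma> a \<le> \<sigma> x" using x(2)[of a] by simp
    then have "reach p (x, b)" using e x(1) unfolding B_def L_def by force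
    moreover have "swings_to (x, b) (e, b) \<or> switches_to (x, b) (e, b)"
    proof (rule swing_or_switch_to_neighbour[OF semimodular pos])
      show "\<not> (\<sigma> x < \<sigma> z \<and> \<sigma> z < \<sigma> e)" if "covered_by z b" for z
        using x(2)[of z] that by (auto simp: L_def)
      show "\<not> (\<sigma> e < \<sigma> z \<and> \<sigma> z < \<sigma> m)" if "covered_by z b" for z
        using m(2)[of z] that by (auto simp: R_def)
    qed (use x m e in \<open>auto simp: B_def L_def R_def\<close>)
    ultimately have "reach p (e, b)"
      using reach_step[of p "(x, b)" "(e, b)"] reach_switch[of p "(x, b)" "(e, b)"]
      by (auto simp: down_or_swing_def swings_to_def)
    then show False using e(1) by (simp add: B_def)
  qed
  define L where "L = {x. covered_by x b \<and> \<sigma> x < \<sigma> c}"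
  have "finite L" "L \<noteq> {}" using ac cov by (auto simp: L_def)
  \<comment> \<open>The immediate predecessor of \<open>c\<close>: maximizing
    \<open>\<sigma>\<close> is minimizing its negative. From \<open>(e, b)\<close> one step down
    leads to \<open>(inf e c, c)\<close>.\<close>
  then obtain e where e: "e \<in> L" "\<And>z. z \<in> L \<Longrightarrow> \<not> - \<sigma> z < - \<sigma> e"
    using arg_min_if_finite[of L "\<lambda>z. - \<sigma> z"] by metis
  have "\<sigma> a \<le> \<sigma> e" using e(2)[of a] ac cov by (simp add: L_def)
  have eb: "covered_by e b" "\<sigma> e < \<sigma> c" using e(1) by (simp_all add: L_def)
  have "\<not> (\<sigma> e < \<sigma> z \<and> \<sigma> z < \<sigma> c)" if "covered_by z b" for z
    using e(2)[of z] that by (auto simp: L_def)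
  then have low: "covered_by (inf e c) c"
    using adjacent_lower_covers(2)[OF semimodular pos eb(1) cov(2) eb(2)] by blast
  have "sup e c = b" using covered_by_sup_eq(1)[OF eb(1) cov(2)] eb(2) by auto
  then have "down_or_swing (e, b) (inf e c, c)"
    using low eb(1) by (simp add: down_or_swing_def prime_interval_def down_perspective_iff)
  moreover have "reach p (e, b)" using all eb \<open>\<sigma> a \<le> \<sigma> e\<close> by blast
  ultimately have "reach p (inf e c, c)" by (rule reach_step[rotated])
  then show ?thesis using eb \<open>\<sigma> a \<le> \<sigma> e\<close> by blast
qed

text \<open>The hypothesis \<open>\<And>z. z < y \<Longrightarrow> z \<le> y'\<close> makes \<open>y\<close> join-irreducible with lower cover \<open>y'\<close>.\<close>

lemma reach_join_irreducible:
  fixes p :: "'a \<times> 'a"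
  assumes y: "y' < y" "\<And>z. z < y \<Longrightarrow> z \<le> y'" and "reach p (a, b)" "y \<le> b" "\<not> y \<le> a"
  shows "reach p (y', y)"
proof -
  \<comment> \<open>The tops \<open>b\<close> of reached intervals that separate \<open>y\<close>; a
    minimal one will turn out to be \<open>y\<close> itself.\<close>
  define B where "B = {b. \<exists>a. reach p (a, b) \<and> y \<le> b \<and> \<not> y \<le> a}"
  have "B \<noteq> {}" using assms by (auto simp: B_def)
  then obtain b where b: "b \<in> B" "\<And>c. c \<in> B \<Longrightarrow> c \<le> b \<Longrightarrow> b = c"
    using finite_has_minimal[of B] by auto
  then obtain a where a: "reach p (a, b)" "y \<le> b" "\<not> y \<le> a" by (auto simp: B_def)
  have ab: "covered_by a b" using reach_prime[OF a(1)] by (simp add: prime_interval_def)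
  show ?thesis
  proof (cases "y = b")
    case True
    then have "a \<le> y'" using y(2) covered_byD[OF ab] by simp
    then have "y' = a" using covered_by_between[OF ab, of y'] y(1) True by (auto simp: less_le)
    then show ?thesis using a(1) True by simp
  next
    case False
    define C where "C = {c. covered_by c b \<and> y \<le> c}"
    have "C \<noteq> {}" using ex_lower_cover[of y b] False a(2) by (auto simp: C_def less_le)
    \<comment> \<open>Among the lower covers of \<open>b\<close> above \<open>y\<close>, the one
      nearest to \<open>a\<close> is taken. The neighbour \<open>e\<close> before it is nearer
      still, hence not above \<open>y\<close>, so \<open>(inf e c, c)\<close> puts the smaller
      element \<open>c\<close> into \<open>B\<close>.\<close>
    define d where "d c = \<bar>slope f c b - slope f a b\<bar>" for c
    obtain c where c: "c \<in> C" "\<And>z. z \<in> C \<Longrightarrow> \<not> d z < d c"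
      using arg_min_if_finite[of C d] \<open>C \<noteq> {}\<close> by auto
    have cb: "covered_by c b" "y \<le> c" using c(1) by (auto simp: C_def)
    then have "c \<noteq> a" using a(3) by auto
    have "\<exists>e. covered_by e b \<and> d e < d c \<and> reach p (inf e c, c)"
    proof (cases "slope f a b < slope f c b")
      case True
      then show ?thesis
        using reach_neighbour[OF left_right_position_slope ab cb(1) _ a(1)] by (force simp: d_def)
    next
      case False
      \<comment> \<open>Negating the position treats a \<open>c\<close> on the other side of
        \<open>a\<close>.\<close>
      then have "- slope f a b < - slope f c b"
        using lower_slope_inj[OF ab cb(1)] \<open>c \<noteq> a\<close> by force
      then show ?thesis
        using reach_neighbour[OF left_right_position_uminus[OF left_right_position_slope] ab cb(1) _ a(1)]
        by (force simp: d_def)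
    qed
    then obtain e where e: "covered_by e b" "d e < d c" "reach p (inf e c, c)" by blast
    then have "\<not> y \<le> e" using c(2)[of e] by (auto simp: C_def)
    then have "c \<in> B" using e(3) cb(2) by (auto simp: B_def)
    then have "b = c" using b(2) covered_byD[OF cb(1)] by simp
    then show ?thesis using covered_byD[OF cb(1)] by simp
  qed
qed

section \<open>The congruence given by the bad join-irreducibles\<close>

lemma collapsed_imp_reach:
  fixes p q :: "'a \<times> 'a"
  assumes p: "prime_interval p" and q: "prime_interval q" and coll: "collapsed_by q (con p)"
  shows "reach p q"
proof -
  define J where "J = {y. \<exists>y'<y. (\<forall>z<y. z \<le> y') \<and> \<not> reach p (y', y)}"
  have avoid: "y \<le> a" if "y \<in> J" "reach p (a, b)" "y \<le> b" for y a b
    using that reach_join_irreducible unfolding J_def by blast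
  \<comment> \<open>A minimal \<open>y\<close> below \<open>b\<close> but not below \<open>a\<close>
    is join-irreducible with lower cover \<open>inf a y\<close>, and \<open>(inf a y, y)\<close> is
    up perspective to \<open>(a, b)\<close>. So either \<open>y\<close> is bad or
    \<open>(a, b)\<close> is reached.\<close>
  have in_J: "\<exists>y. y \<le> b \<and> \<not> y \<le> a \<and> (y \<in> J \<or> reach p (a, b))" if ab: "covered_by a b" for a b
  proof -
    define Y where "Y = {y. y \<le> b \<and> \<not> y \<le> a}"
    have "b \<in> Y" using covered_byD[OF ab] by (auto simp: Y_def)
    then obtain y where y: "y \<in> Y" "\<And>z. z \<in> Y \<Longrightarrow> z \<le> y \<Longrightarrow> y = z"
      using finite_has_minimal[of Y] by auto
    have ya: "y \<le> b" "\<not> y \<le> a" using y(1) by (auto simp: Y_def)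
    have below: "z \<le> inf a y" if "z < y" for z
      using y(2)[of z] that order_trans[of z y b] ya(1) by (auto simp: Y_def less_le)
    have lt: "inf a y < y" using ya(2) by (metis inf.cobounded1 inf.cobounded2 less_le)
    have "reach p (a, b)" if "reach p (inf a y, y)"
      using reach_up[OF that, of a] ya sup_eq_of_covered_by[OF ab ya] by (simp add: sup.commute)
    then have "y \<in> J \<or> reach p (a, b)" using lt below unfolding J_def by blast
    then show ?thesis using ya by blast
  qed
  define \<theta> where "\<theta> = {(a, b). \<forall>y\<in>J. y \<le> a \<longleftrightarrow> y \<le> b}"
  \<comment> \<open>On the way from \<open>inf a b\<close> up to \<open>a\<close>, some cover from
    \<open>s\<close> to \<open>t\<close> first brings \<open>y\<close> below the join with
    \<open>c\<close>. A bad element below \<open>t\<close> is below \<open>a\<close>, hence below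
    \<open>inf a b\<close> and \<open>s\<close>; so \<open>(s, t)\<close> is reached. Then the
    interval from \<open>sup s c\<close> to \<open>sup t c\<close> is reached too, and it separates
    the bad \<open>y\<close>, contradicting \<open>avoid\<close>.\<close>
  have sup_closed: "y \<le> sup b c" if ab: "(a, b) \<in> \<theta>" and y: "y \<in> J" "y \<le> sup a c" for a b c y
  proof (rule ccontr)
    assume "\<not> y \<le> sup b c"
    then have nle: "\<not> y \<le> sup (inf a b) c"
      by (meson inf.cobounded2 order_refl order_trans sup_mono)
    define X where "X = {x. inf a b \<le> x \<and> x \<le> a \<and> \<not> y \<le> sup x c}"
    have "inf a b \<in> X" using nle by (simp add: X_def)
    then obtain s where s: "s \<in> X" "\<And>z. z \<in> X \<Longrightarrow> s \<le> z \<Longrightarrow> s = z"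
      using finite_has_maximal[of X] by auto
    have "s < a" using s(1) y(2) by (auto simp: X_def less_le)
    then obtain t where t: "covered_by s t" "t \<le> a" using ex_upper_cover by blast
    have "inf a b \<le> t" using s(1) covered_byD[OF t(1)] by (auto simp: X_def)
    then have yt: "y \<le> sup t c"
      using s(2)[of t] t covered_byD[OF t(1)] by (auto simp: X_def less_le)
    have ys: "\<not> y \<le> sup s c" using s(1) by (simp add: X_def)
    obtain z where z: "z \<le> t" "\<not> z \<le> s" "z \<in> J \<or> reach p (s, t)" using in_J[OF t(1)] by blast
    have "z \<notin> J"
    proof
      assume "z \<in> J"
      moreover have "z \<le> a" using z(1) t(2) by (rule order_trans)
      ultimately have "z \<le> inf a b" using ab by (simp add: \<theta>_def)
      also have "\<dots> \<le> s" using s(1) by (simp add: X_def)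
      finally show False using z(2) by simp
    qed
    then have "reach p (s, t)" using z(3) by simp
    moreover have "\<not> t \<le> sup s c" using yt ys by (metis le_sup_iff order_trans sup_ge2)
    ultimately have "reach p (sup s c, sup t (sup s c))" using reach_up[of p s t] by simp
    moreover have "y \<le> sup t (sup s c)" using yt by (meson order_trans sup.cobounded1 sup.cobounded2 sup.mono order_refl)
    ultimately show False using avoid y(1) ys by blast
  qed
  have \<theta>_sym: "(b, a) \<in> \<theta>" if "(a, b) \<in> \<theta>" for a b using that by (auto simp: \<theta>_def)
  have "lattice_congruence \<theta>"
    unfolding lattice_congruence_def
  proof (intro conjI allI impI)
    show "equiv UNIV \<theta>"
      by (rule equivI) (auto simp: \<theta>_def refl_on_def sym_def trans_def)
    fix a b c d assume ab: "(a, b) \<in> \<theta>" and cd: "(c, d) \<in> \<theta>"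
    show "(inf a c, inf b d) \<in> \<theta>" using ab cd by (auto simp: \<theta>_def)
    \<comment> \<open>The two arguments of the join are replaced one after the other.\<close>
    have *: "y \<le> sup b d" if y: "y \<in> J" "y \<le> sup a c" and ab: "(a, b) \<in> \<theta>" and cd: "(c, d) \<in> \<theta>" for y a b c d
    proof -
      have "y \<le> sup c b" using sup_closed[OF ab y] by (simp add: sup.commute)
      then show ?thesis using sup_closed[OF cd y(1)] by (simp add: sup.commute)
    qed
    have "y \<le> sup a c \<longleftrightarrow> y \<le> sup b d" if "y \<in> J" for y
      using *[OF that _ ab cd] *[OF that _ \<theta>_sym[OF ab] \<theta>_sym[OF cd]] by blast
    then show "(sup a c, sup b d) \<in> \<theta>" by (simp add: \<theta>_def)
  qed
  moreover have "collapsed_by p \<theta>"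
  proof -
    obtain a b where [simp]: "p = (a, b)" by (metis surj_pair)
    have "a \<le> b" using p covered_byD[of a b] by (simp add: prime_interval_def)
    then have "y \<le> a \<longleftrightarrow> y \<le> b" if "y \<in> J" for y
      using avoid[OF that, of a b] reach_refl[OF p] order_trans[of y a b] by auto
    then show ?thesis by (simp add: collapsed_by_def \<theta>_def)
  qed
  ultimately have "collapsed_by q \<theta>" using con_least coll unfolding collapsed_by_def by blast
  \<comment> \<open>As no bad element separates \<open>u\<close> from \<open>v\<close>,
    \<open>in_J\<close> leaves only that \<open>q\<close> is reached.\<close>
  moreover obtain u v where [simp]: "q = (u, v)" by (metis surj_pair)
  ultimately show ?thesis
    using in_J[of u v] q unfolding collapsed_by_def \<theta>_def prime_interval_def by auto
qed

end

theorem lemma8: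
  fixes p q :: "'a::{finite, lattice} \<times> 'a"
  assumes "planar TYPE('a)" and "upper_semimodular TYPE('a)"
    and "prime_interval p" and "prime_interval q" and "p \<noteq> q"
  shows "collapsed_by q (con p) \<longleftrightarrow>
    (\<exists>(n::nat) P Q.
       P 0 = p \<and> Q n = q \<and>
       (\<forall>k\<le>n. prime_interval (P k) \<and> prime_interval (Q k) \<and> sps_projective (P k) (Q k)) \<and>
       (\<forall>k<n. switches_to (Q k) (P (Suc k))))"
proof
  obtain f :: "'a \<Rightarrow> real \<times> real" where "planar_diagram f"
    using assms(1) unfolding planar_def by blast
  then interpret planar_semimodular_lattice f
    using assms(2) by unfold_locales
  assume "collapsed_by q (con p)"
  then show "\<exists>(n::nat) P Q.
       P 0 = p \<and> Q n = q \<and>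
       (\<forall>k\<le>n. prime_interval (P k) \<and> prime_interval (Q k) \<and> sps_projective (P k) (Q k)) \<and>
       (\<forall>k<n. switches_to (Q k) (P (Suc k)))"
    by (intro reach_imp_sequences collapsed_imp_reach assms)
next
  assume "\<exists>(n::nat) P Q.
       P 0 = p \<and> Q n = q \<and>
       (\<forall>k\<le>n. prime_interval (P k) \<and> prime_interval (Q k) \<and> sps_projective (P k) (Q k)) \<and>
       (\<forall>k<n. switches_to (Q k) (P (Suc k)))"
  then obtain n :: nat and P Q where PQ: "P 0 = p" "Q n = q"
    "\<And>k. k \<le> n \<Longrightarrow> sps_projective (P k) (Q k)" "\<And>k. k < n \<Longrightarrow> switches_to (Q k) (P (Suc k))"
    by blast
  show "collapsed_by q (con p)"
    unfolding PQ(2)[symmetric]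
    by (rule collapsed_by_sequences[of "con p" P n Q])
      (simp_all add: PQ(1,3,4) collapsed_by_con lattice_congruence_con)
qed

end
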